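(* Let $h\ge2$ be even, $u\in(\mathbb Z/h\mathbb Z)^\times$, and let $b_{h,u}$, $\mathcal P_{h,u}$, $\mathcal R_{h,u}$ be as in the context. Then $$Y^{h-1}\mathcal P_{h,u}(Y^{-1})=-\mathcal P_{h,u}(Y),$$ and $\mathcal R_{h,u}$ is odd. Moreover, $$L(-1,b_{h,u})=\mathcal P'_{h,u}(1)=\frac12\mathcal R'_{h,u}(0),$$ and (in a neighbourhood of $x=0$, equivalently as power series in $x$) $$\sum_{n\ge0}L(-2n-1,b_{h,u})\frac{x^{2n+1}}{(2n+1)!}=\frac{\mathcal R_{h,u}(x)}{2\cosh(hx)}.$$ Consequently, for $$A_n(h,u):=\frac{L(-2n-1,b_{h,u})}{L(-1,b_{h,u})}\qquad(n\ge0),$$ one has $$\sum_{n\ge0}A_n(h,u)\frac{x^{2n+1}}{(2n+1)!}=\frac{\mathcal R_{h,u}(x)}{\mathcal R'_{h,u}(0)\cosh(hx)}.$$ The same values also satisfy, for every $n\ge0$, $$A_n(h,u)=(-1)^n(2n+1)!\left(\frac{2h}{\pi}\right)^{2n}\frac{L(2n+2,b_{h,u^\vee})}{L(2,b_{h,u^\vee})},$$ and, as $n\to\infty$, $$A_n(h,u)=\frac{(-1)^n(2n+1)!}{L(2,b_{h,u^\vee})}\left(\frac{2h}{\pi}\right)^{2n}\left(1+O(3^{-2n-2})\right).$$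
   Context: Write $e(x)=e^{2\pi ix}$ and $T_k=k(k+1)/2$. Let $h\ge2$ be even, $u\in(\mathbb Z/h\mathbb Z)^\times$, and $\lambda=e(u/h)$. The sequence $b_{h,u}:\mathbb Z\to\mathbb C$ is $b_{h,u}(2k+1):=\lambda^{T_k}$, $b_{h,u}(2k):=0$ ($k\in\mathbb Z$); it is $4h$-periodic, even, and of mean zero. The dual parameter is $u^\vee:=-u^{-1}\in(\mathbb Z/h\mathbb Z)^\times$. For $\Re(s)>1$, $L(s,b_{h,u}):=\sum_{m\ge1}b_{h,u}(m)m^{-s}$, continued to $\mathbb C$ by $L(s,b_{h,u})=(4h)^{-s}\sum_{r=1}^{4h}b_{h,u}(r)\zeta(s,r/(4h))$ (Hurwitz zeta function). It is known that $L(-2n-1,b_{h,u})\ne0$ for all $n\ge0$. Define $$\mathcal P_{h,u}(Y):=\sum_{k=0}^{h-1}\lambda^{T_k}Y^k,\qquad \mathcal R_{h,u}(x):=e^{(1-h)x}\,\mathcal P_{h,u}(e^{2x}).$$ *)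

theory Defs
  imports
    "HOL-Analysis.Analysis"
    "HOL-Computational_Algebra.Polynomial"
    "HOL-Library.Landau_Symbols"
    "HOL-Number_Theory.Modular_Inverse"
begin

text \<open>
  Throughout, a unit of \<open>\<int>/h\<int>\<close> is represented by an integer \<open>u\<close> with \<open>coprime u (int h)\<close>.
  All objects below depend on \<open>u\<close> only through its residue class modulo \<open>h\<close>.
\<close>

definition e2pi :: "real \<Rightarrow> complex" where
  "e2pi x = exp (2 * of_real pi * \<i> * of_real x)"

text \<open>The division is exact, since \<open>k * (k + 1)\<close> is even.\<close>
definition tri :: "int \<Rightarrow> int" where
  "tri k = k * (k + 1) div 2"

definition lam :: "nat \<Rightarrow> int \<Rightarrow> complex" where
  "lam h u = e2pi (of_int u / of_nat h)"

definition dual_param :: "nat \<Rightarrow> int \<Rightarrow> int" where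
  "dual_param h u = (- modular_inverse (int h) u) mod int h"

definition b_seq :: "nat \<Rightarrow> int \<Rightarrow> int \<Rightarrow> complex" where
  "b_seq h u m = (if odd m then lam h u powi tri ((m - 1) div 2) else 0)"

text \<open>
  For \<open>a > 0\<close>, the Hurwitz zeta function is the holomorphic function on \<open>\<complex> - {1}\<close>
  (unique there by the identity theorem) that extends the series \<open>\<Sum>n. (n + a) powr (-s)\<close>
  from the half-plane \<open>Re s > 1\<close>. Its value at the pole \<open>s = 1\<close> is not specified.
\<close>
definition hurwitz_zeta :: "complex \<Rightarrow> real \<Rightarrow> complex" where
  "hurwitz_zeta s a =
     (SOME f. f holomorphic_on (- {1}) \<and>
        (\<forall>z. Re z > 1 \<longrightarrow> (\<lambda>n. of_real (real n + a) powr (- z)) sums f z)) s"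

definition L_hurwitz :: "nat \<Rightarrow> int \<Rightarrow> complex \<Rightarrow> complex" where
  "L_hurwitz h u s = of_nat (4 * h) powr (- s) *
     (\<Sum>r = 1..4 * h. b_seq h u (int r) * hurwitz_zeta s (real r / real (4 * h)))"

text \<open>
  The expression in Hurwitz zeta functions has a removable singularity at \<open>s = 1\<close>
  because \<open>b_seq h u\<close> has mean zero; the value there is the limit.
\<close>
definition L_fun :: "complex \<Rightarrow> nat \<Rightarrow> int \<Rightarrow> complex" where
  "L_fun s h u =
     (if Re s > 1 then \<Sum>n. b_seq h u (int (Suc n)) * of_nat (Suc n) powr (- s)
      else if s = 1 then Lim (at 1) (L_hurwitz h u)
      else L_hurwitz h u s)"

definition P_poly :: "nat \<Rightarrow> int \<Rightarrow> complex poly" where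
  "P_poly h u = (\<Sum>k<h. monom (lam h u powi tri (int k)) k)"

definition R_fun :: "nat \<Rightarrow> int \<Rightarrow> complex \<Rightarrow> complex" where
  "R_fun h u x = exp ((1 - of_nat h) * x) * poly (P_poly h u) (exp (2 * x))"

definition A_ratio :: "nat \<Rightarrow> nat \<Rightarrow> int \<Rightarrow> complex" where
  "A_ratio n h u = L_fun (- 2 * of_nat n - 1) h u / L_fun (- 1) h u"

end

theory Submission
  imports Defs "HOL-Complex_Analysis.Complex_Analysis"
begin

text \<open>
  Write \<open>c_k\<close> for \<open>\<lambda>\<^bsup>T_k\<^esup>\<close>. The arithmetic input is a sign and a quadratic Gauss sum. Since \<open>h\<close>
  is even and \<open>u\<close> is odd, \<open>T\<^bsub>k+h\<^esub> - T_k = h (2 k + 1 + h) / 2\<close> is an odd multiple of \<open>h / 2\<close>,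
  so \<open>c\<^bsub>k+h\<^esub> = - c_k\<close> (lemma \<open>lam_powi_tri_add_h\<close>). Together with \<open>T\<^bsub>-1-k\<^esub> = T_k\<close> this gives the
  antipalindromic symmetry of \<open>P\<close>, hence the oddness of \<open>R\<close>. It also folds every sum over a
  period of \<open>b\<close> to a sum over \<open>k < h\<close> (lemma \<open>sum_b_seq\<close>). For the Gauss sum, completing the
  square shows that the discrete Fourier transform of \<open>b\<^bsub>h,u\<^esub>\<close> is a nonzero constant times the
  sequence \<open>b\<^bsub>h,w\<^esub>\<close> for the dual parameter \<open>w = - 1 / u\<close> modulo \<open>h\<close> (lemmas \<open>gauss_sum_odd\<close>,
  \<open>gauss_sum_nonzero\<close>, \<open>sum_b_seq_cos\<close>).

  On the analytic side all \<open>L\<close>-values come from Bernoulli polynomials. The continuation of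
  the Hurwitz zeta function is produced by Euler-Maclaurin summation: subtracting from \<open>x\<^bsup>-s\<^esup>\<close>
  the difference of an approximate primitive leaves a remainder of size \<open>x\<^bsup>-Re s-N\<^esup>\<close>, whose sum
  over \<open>x = n + a\<close> is holomorphic for \<open>Re s > 1 - N\<close>. At \<open>s = -m\<close> the primitive is exact and
  the remainder vanishes, so \<open>\<zeta>(-m,a) = - B\<^bsub>m+1\<^esub>(a) / (m+1)\<close> (lemma \<open>hurwitz_zeta_neg_nat\<close>).

  Two descriptions of the Bernoulli polynomials then give the two halves of the theorem.
  Their exponential generating function \<open>x e\<^bsup>ax\<^esup> / (e\<^bsup>x\<^esup> - 1)\<close> turns the values \<open>L(-n)\<close> into the
  Taylor coefficients of \<open>- \<Sum>b(r) e\<^bsup>rx\<^esup> / (e\<^bsup>4hx\<^esup> - 1) = R(x) / (2 cosh (h x))\<close> (lemma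
  \<open>L_fps_expansion\<close>); the oddness of \<open>R\<close> leaves only odd powers, and the linear coefficient
  gives \<open>L(-1) = P'(1)\<close>. Their Fourier expansion on \<open>[0,1]\<close> (lemma \<open>bern_eq_bern_fourier\<close>)
  and the Gauss sum turn \<open>L(-2n-1)\<close> into an explicit constant times \<open>L(2n+2)\<close> at the dual
  parameter (lemma \<open>L_fun_functional_equation\<close>), and in the quotient \<open>A_n\<close> the Gauss sum
  cancels. Finally \<open>b(1) = 1\<close> and \<open>b\<close> vanishes at \<open>2\<close>, so \<open>L(2n+2) = 1 + O(3\<^bsup>-2n-2\<^esup>)\<close> (lemma
  \<open>norm_L_fun_minus_1_le\<close>).
\<close>

section \<open>Normalised Bernoulli polynomials\<close>

text \<open>
  The number \<open>B_j / j!\<close>: the series under the inverse is \<open>(e\<^bsup>X\<^esup> - 1) / X\<close>.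
\<close>
definition bern_coeff :: "nat \<Rightarrow> real" where
  "bern_coeff j = fps_nth (inverse (Abs_fps (\<lambda>n. 1 / fact (Suc n)))) j"

text \<open>
  The normalised Bernoulli polynomial \<open>B_n(t) / n!\<close>. With this normalisation each polynomial
  is the derivative of the next one, which removes all binomial factors from the
  Euler-Maclaurin and Fourier arguments.
\<close>
definition bern :: "nat \<Rightarrow> 'a :: real_normed_field \<Rightarrow> 'a" where
  "bern n t = (\<Sum>j\<le>n. of_real (bern_coeff j) * t ^ (n - j) / fact (n - j))"

lemma bern_coeff_recurrence:
  "(\<Sum>j\<le>n. bern_coeff j / fact (Suc (n - j))) = (if n = 0 then 1 else 0)"
proof -
  define A :: "real fps" where "A = Abs_fps (\<lambda>n. 1 / fact (Suc n))"
  have "inverse A * A = 1"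
    by (rule inverse_mult_eq_1) (simp add: A_def)
  then have "fps_nth (inverse A * A) n = (if n = 0 then 1 else 0)"
    by simp
  then show ?thesis
    by (simp add: fps_mult_nth A_def bern_coeff_def atLeast0AtMost del: fact_Suc)
qed

lemma bern_0 [simp]: "bern n 0 = of_real (bern_coeff n)"
  by (simp add: bern_def sum.remove[of "{..n}" n] power_0_left)

lemma bern_at_1: "bern n 1 = (of_real (bern_coeff n) + (if n = 1 then 1 else 0) :: 'a :: real_normed_field)"
proof (cases n)
  case (Suc k)
  have "bern n 1 = of_real (bern_coeff n) + (of_real (\<Sum>j\<le>k. bern_coeff j / fact (Suc (k - j))) :: 'a)"
    by (simp add: bern_def Suc Suc_diff_le del: fact_Suc)
  then show ?thesis
    by (simp only: bern_coeff_recurrence) (simp add: Suc)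
qed (simp add: bern_def)

lemma bern_of_real: "bern n (of_real t) = (of_real (bern n t) :: 'a :: real_normed_field)"
  by (simp add: bern_def)

lemma has_field_derivative_bern:
  "((bern (Suc n) :: 'a \<Rightarrow> 'a :: real_normed_field) has_field_derivative bern n t) (at t within S)"
proof -
  have *: "of_nat (Suc n - j) * t ^ (n - j) / fact (Suc n - j) = t ^ (n - j) / fact (n - j)"
    if "j \<le> n" for j
    using that by (simp add: Suc_diff_le divide_simps del: of_nat_Suc)
  have "((\<lambda>t. \<Sum>j\<le>Suc n. of_real (bern_coeff j) * t ^ (Suc n - j) / fact (Suc n - j))
          has_field_derivative
            (\<Sum>j\<le>Suc n. of_real (bern_coeff j) * (of_nat (Suc n - j) * t ^ (Suc n - j - 1))
                / fact (Suc n - j))) (at t within S)"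
    by (auto intro!: derivative_eq_intros sum.cong simp del: fact_Suc)
  also have "(\<Sum>j\<le>Suc n. of_real (bern_coeff j) * (of_nat (Suc n - j) * t ^ (Suc n - j - 1))
                / fact (Suc n - j)) = bern n t"
    using * by (simp add: bern_def mult.assoc flip: times_divide_eq_right)
  finally show ?thesis
    by (simp add: bern_def[abs_def])
qed

lemma bern_coeff_0: "bern_coeff 0 = 1"
  using bern_coeff_recurrence[of 0] by simp

lemma bern_coeff_1: "bern_coeff (Suc 0) = - 1 / 2"
  using bern_coeff_recurrence[of 1] by (simp add: bern_coeff_0)

text \<open>
  The generating function \<open>x e\<^bsup>ax\<^esup> / (e\<^bsup>x\<^esup> - 1)\<close> at \<open>a = r / q\<close>, with \<open>q x\<close> in place of \<open>x\<close>.
  Multiplying out the denominator avoids dividing by a series without constant term.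
\<close>
lemma bern_fps_scaled:
  fixes q r :: complex assumes "q \<noteq> 0"
  shows "Abs_fps (\<lambda>j. of_real (bern_coeff j) * q ^ j) * (fps_exp q - 1) = fps_const q * fps_X"
    and "fps_nth (Abs_fps (\<lambda>j. of_real (bern_coeff j) * q ^ j) * fps_exp r) n = q ^ n * bern n (r / q)"
proof -
  let ?B = "Abs_fps (\<lambda>j. of_real (bern_coeff j) * q ^ j)"
  show *: "fps_nth (?B * fps_exp r) n = q ^ n * bern n (r / q)" for r n
  proof -
    have "fps_nth ?B j * fps_nth (fps_exp r) (n - j) =
          q ^ n * (of_real (bern_coeff j) * (r / q) ^ (n - j) / fact (n - j))" if "j \<le> n" for j
    proof -
      have "q ^ n = q ^ j * q ^ (n - j)"
        using that by (simp flip: power_add)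
      then show ?thesis
        using assms by (simp add: power_divide)
    qed
    then show ?thesis
      unfolding fps_mult_nth bern_def sum_distrib_left atLeast0AtMost by (intro sum.cong) auto
  qed
  have "fps_nth (?B * (fps_exp q - 1)) n = fps_nth (fps_const q * fps_X) n" for n
    using *[of q n] assms by (cases "n = 1") (auto simp: ring_distribs bern_at_1)
  then show "?B * (fps_exp q - 1) = fps_const q * fps_X"
    by (rule fps_ext)
qed

section \<open>Continuation of the Hurwitz zeta function\<close>

text \<open>
  The coefficient in \<open>D\<^bsup>j-1\<^esup> x\<^bsup>-s\<^esup> = pow_deriv j s * x\<^bsup>1-s-j\<^esup>\<close>, where \<open>D\<^bsup>-1\<^esup>\<close> is the primitive
  \<open>x\<^bsup>1-s\<^esup> / (1 - s)\<close>. The equation for \<open>j = 1\<close> is separate so that all coefficients with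
  \<open>j \<ge> 1\<close> are polynomials in \<open>s\<close>, also at the pole \<open>s = 1\<close> of the primitive.
\<close>
fun pow_deriv :: "nat \<Rightarrow> complex \<Rightarrow> complex" where
  "pow_deriv 0 s = 1 / (1 - s)"
| "pow_deriv (Suc 0) s = 1"
| "pow_deriv (Suc (Suc j)) s = (- s - of_nat j) * pow_deriv (Suc j) s"

lemma pow_deriv_Suc: "s \<noteq> 1 \<Longrightarrow> pow_deriv (Suc j) s = (1 - s - of_nat j) * pow_deriv j s"
  by (cases j) (auto simp: algebra_simps)

lemma pow_deriv_holomorphic: "pow_deriv j holomorphic_on (- {1})"
proof -
  have Suc: "pow_deriv (Suc j) holomorphic_on (- {1})" for j
  proof (induction j)
    case 0
    have "pow_deriv (Suc 0) = (\<lambda>s. 1)" by (rule ext) simp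
    then show ?case by simp
  next
    case (Suc j)
    have "pow_deriv (Suc (Suc j)) = (\<lambda>s. (- s - of_nat j) * pow_deriv (Suc j) s)" by (rule ext) simp
    moreover have "(\<lambda>s. (- s - of_nat j) * pow_deriv (Suc j) s) holomorphic_on (- {1})"
      by (intro holomorphic_on_mult Suc) (intro holomorphic_intros)
    ultimately show ?case by (simp only:)
  qed
  show ?thesis
  proof (cases j)
    case 0
    have "pow_deriv 0 = (\<lambda>s. 1 / (1 - s))" by (rule ext) simp
    moreover have "(\<lambda>s::complex. 1 / (1 - s)) holomorphic_on (- {1})"
      by (intro holomorphic_intros) auto
    ultimately show ?thesis by (simp only: 0)
  qed (use Suc in simp)
qed

lemma neg_of_nat_neq_1: "- of_nat m \<noteq> (1 :: complex)"
proof
  assume "- of_nat m = (1 :: complex)"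
  then have "Re (- of_nat m) = 1" by (simp only: one_complex.sel)
  then show False by simp
qed

text \<open>
  For \<open>x\<^bsup>m\<^esup>\<close> the iterated derivatives stop after \<open>m + 1\<close> steps; this is why Euler-Maclaurin
  summation is exact at \<open>s = -m\<close>.
\<close>
lemma pow_deriv_neg_nat:
  "pow_deriv j (- of_nat m) = (if j \<le> Suc m then fact m / fact (Suc m - j) else 0)"
proof (induction j)
  case 0
  have "pow_deriv 0 (- of_nat m) = 1 / of_nat (Suc m)" by simp
  moreover have "(fact (Suc m) :: complex) = of_nat (Suc m) * fact m" by (rule fact_Suc)
  ultimately show ?case by (simp del: of_nat_Suc fact_Suc pow_deriv.simps)
next
  case (Suc j)
  from pow_deriv_Suc[OF neg_of_nat_neq_1] have "pow_deriv (Suc j) (- of_nat m) = (of_nat (Suc m) - of_nat j) * pow_deriv j (- of_nat m)"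
    by (simp add: algebra_simps)
  also have "\<dots> = (if Suc j \<le> Suc m then fact m / fact (Suc m - Suc j) else 0)"
  proof (cases "j \<le> m")
    case True
    have fact: "(fact (Suc m - j) :: complex) = of_nat (Suc m - j) * fact (m - j)"
      using True by (simp only: Suc_diff_le fact_Suc)
    have diff: "(of_nat (Suc m) - of_nat j :: complex) = of_nat (Suc m - j)"
      using True by (intro of_nat_diff[symmetric]) simp
    have nz: "of_nat (Suc m - j) \<noteq> (0 :: complex)"
      using True by (simp only: of_nat_eq_0_iff)
    have "pow_deriv j (- of_nat m) = fact m / (of_nat (Suc m - j) * fact (m - j))"
      using True unfolding Suc fact by (simp only: le_SucI if_True)
    then have "(of_nat (Suc m) - of_nat j) * pow_deriv j (- of_nat m) = fact m / fact (m - j)"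
      unfolding diff using nz by (simp only: times_divide_eq_right mult_divide_mult_cancel_left[OF nz])
    with True show ?thesis
      by (simp only: diff_Suc_Suc Suc_le_mono if_True)
  next
    case False
    then show ?thesis by (cases "j = Suc m") (auto simp: Suc)
  qed
  finally show ?case .
qed

text \<open>
  The approximate primitive \<open>\<Sum> B_j / j! D\<^bsup>j-1\<^esup> x\<^bsup>-s\<^esup>\<close> of Euler-Maclaurin summation: its forward
  difference agrees with \<open>x\<^bsup>-s\<^esup>\<close> up to the remainder below.
\<close>
definition em_primitive :: "nat \<Rightarrow> complex \<Rightarrow> real \<Rightarrow> complex" where
  "em_primitive N s x = (\<Sum>j\<le>N. of_real (bern_coeff j) * pow_deriv j s * of_real x powr (1 - s - of_nat j))"

definition em_remainder :: "nat \<Rightarrow> complex \<Rightarrow> real \<Rightarrow> complex" where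
  "em_remainder N s x = of_real x powr (- s) - (em_primitive N s (x + 1) - em_primitive N s x)"

text \<open>
  The remainder is \<open>W(0) - W(1)\<close> for \<open>W(t) = \<Sum>\<^bsub>j\<le>N\<^esub> B_j(1-t) / j! D\<^bsup>j-1\<^esup> (x+t)\<^bsup>-s\<^esup>\<close>, because
  \<open>B_j(0) = B_j(1)\<close> except at \<open>j = 1\<close>. The derivative of \<open>W\<close> telescopes to its last term
  \<open>B_N(1-t) / N! D\<^bsup>N\<^esup> (x+t)\<^bsup>-s\<^esup>\<close>, so the mean value inequality gives the bound; this takes the
  place of the usual remainder integral.
\<close>
lemma em_remainder_bound:
  assumes "N \<ge> 1"
  obtains M where "M \<ge> 0" and "\<And>s x. s \<noteq> 1 \<Longrightarrow> x > 0 \<Longrightarrow> Re s + N \<ge> 0 \<Longrightarrow>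
    norm (em_remainder N s x) \<le> M * norm (pow_deriv (Suc N) s) * x powr (- Re s - N)"
proof -
  have "compact ((\<lambda>t::complex. bern N (1 - t)) ` closed_segment 0 1)"
  proof (rule compact_continuous_image)
    show "continuous_on (closed_segment 0 1) (\<lambda>t::complex. bern N (1 - t))"
      unfolding bern_def by (intro continuous_intros) auto
  qed (rule compact_segment)
  then obtain M where M: "M > 0" "\<And>z. z \<in> (\<lambda>t::complex. bern N (1 - t)) ` closed_segment 0 1 \<Longrightarrow> norm z \<le> M"
    using compact_imp_bounded bounded_pos by metis
  have "norm (em_remainder N s x) \<le> M * norm (pow_deriv (Suc N) s) * x powr (- Re s - N)"
    if s: "s \<noteq> 1" and x: "x > 0" and Re: "Re s + N \<ge> 0" for s x
  proof -
    define g where "g = (\<lambda>j t. pow_deriv j s * (of_real x + t) powr (1 - s - of_nat j))"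
    define W where "W = (\<lambda>t. \<Sum>j\<le>N. bern j (1 - t) * g j t)"
    have seg: "\<exists>u\<in>{0..1}. t = of_real u" if "t \<in> closed_segment 0 (1 :: complex)" for t
      using that unfolding closed_segment_def by (auto simp: scaleR_conv_of_real)
    have nonneg: "of_real x + t \<notin> \<real>\<^sub>\<le>\<^sub>0" if "t \<in> closed_segment 0 1" for t :: complex
      using seg[OF that] x by (auto simp flip: of_real_add)
    have dg: "(g j has_field_derivative g (Suc j) t) (at t within S)" if "t \<in> closed_segment 0 1" for j t S
      unfolding g_def pow_deriv_Suc[OF s] using nonneg[OF that]
      by (auto intro!: derivative_eq_intros simp: algebra_simps)
    have bern0: "bern 0 t = 1" for t :: complex
      by (simp add: bern_def bern_coeff_0)
    have dW: "(W has_field_derivative bern N (1 - t) * g (Suc N) t) (at t within S)"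
      if "t \<in> closed_segment 0 1" for t S
    proof -
      have db: "((\<lambda>t::complex. bern (Suc j) (1 - t)) has_field_derivative - bern j (1 - t)) (at t within S)" for j
      proof -
        have "((\<lambda>t::complex. 1 - t) has_field_derivative - 1) (at t within S)"
          by (auto intro!: derivative_eq_intros)
        from DERIV_chain2[OF has_field_derivative_bern[of j "1 - t" UNIV] this] show ?thesis
          by simp
      qed
      have "((\<lambda>t. \<Sum>j\<le>n. bern j (1 - t) * g j t) has_field_derivative bern n (1 - t) * g (Suc n) t) (at t within S)" for n
      proof (induction n)
        case 0
        then show ?case using dg[OF that] by (simp add: bern0)
      next
        case (Suc n)
        from DERIV_add[OF this DERIV_mult[OF db[of n] dg[OF that, of "Suc n"]]] show ?case
          by (simp add: mult.commute)
      qed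
      then show ?thesis by (simp add: W_def)
    qed
    have "norm (W 1 - W 0) \<le> M * norm (pow_deriv (Suc N) s) * x powr (- Re s - N) * norm (1 - 0 :: complex)"
    proof (rule field_differentiable_bound[OF convex_closed_segment dW])
      fix t :: complex assume t: "t \<in> closed_segment 0 1"
      then obtain u where u: "u \<in> {0..1}" "t = of_real u" using seg by blast
      have "norm (g (Suc N) t) = norm (pow_deriv (Suc N) s) * (x + u) powr (- Re s - N)"
        using x u by (simp add: g_def norm_mult norm_powr_real_powr flip: of_real_add)
      also have "\<dots> \<le> norm (pow_deriv (Suc N) s) * x powr (- Re s - N)"
        using x u Re by (intro mult_left_mono powr_mono2') auto
      finally show "norm (bern N (1 - t) * g (Suc N) t) \<le> M * norm (pow_deriv (Suc N) s) * x powr (- Re s - N)"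
        unfolding norm_mult mult.assoc using M(1) M(2)[OF imageI[OF t]] by (intro mult_mono) auto
    qed auto
    moreover have "W 1 = em_primitive N s (x + 1)"
      by (simp add: W_def g_def em_primitive_def mult.assoc)
    moreover have "W 0 = em_primitive N s x + of_real x powr (- s)"
    proof -
      have "(\<Sum>j\<le>N. (if j = 1 then 1 else 0) * g j 0) = (\<Sum>j\<in>{1}. g j 0)"
        using assms by (intro sum.mono_neutral_cong_right) auto
      then show ?thesis
        by (simp add: W_def bern_at_1 ring_distribs sum.distrib g_def em_primitive_def mult.assoc)
    qed
    ultimately show ?thesis
      using norm_minus_commute by (simp add: em_remainder_def norm_minus_commute algebra_simps)
  qed
  with M that[of M] show ?thesis by auto
qed

text \<open>
  The bound for the remainder contains the factor \<open>pow_deriv (N + 1) (-m)\<close>, which is zero.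
\<close>
lemma em_remainder_neg_nat:
  assumes "m < N" "x > 0"
  shows "em_remainder N (- of_nat m) x = 0"
proof -
  obtain M where M: "\<And>s x. s \<noteq> 1 \<Longrightarrow> x > 0 \<Longrightarrow> Re s + N \<ge> 0 \<Longrightarrow>
    norm (em_remainder N s x) \<le> M * norm (pow_deriv (Suc N) s) * x powr (- Re s - N)"
    by (rule em_remainder_bound[of N]) (use assms in auto)
  have "pow_deriv (Suc N) (- of_nat m) = 0"
    unfolding pow_deriv_neg_nat using assms by simp
  moreover have "norm (em_remainder N (- of_nat m) x) \<le> M * norm (pow_deriv (Suc N) (- of_nat m)) *
      x powr (- Re (- of_nat m) - N)"
    using assms by (intro M neg_of_nat_neq_1) auto
  ultimately show ?thesis
    by simp
qed

text \<open>
  Formally the sum of \<open>(n + a)\<^bsup>-s\<^esup>\<close>: the differences of the primitive that the remainders leave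
  out telescope to minus its value at \<open>a\<close>.
\<close>
definition hurwitz_em :: "nat \<Rightarrow> real \<Rightarrow> complex \<Rightarrow> complex" where
  "hurwitz_em N a s = (\<Sum>n. em_remainder N s (real n + a)) - em_primitive N s a"

definition punctured_halfplane :: "nat \<Rightarrow> complex set" where
  "punctured_halfplane N = {s. Re s > 1 - real N} - {1}"

lemma open_punctured_halfplane: "open (punctured_halfplane N)"
  unfolding punctured_halfplane_def by (intro open_delete open_halfspace_Re_gt)

lemma connected_punctured_halfplane: "connected (punctured_halfplane N)"
  unfolding punctured_halfplane_def
  by (intro connected_open_delete open_halfspace_Re_gt convex_connected convex_halfspace_Re_gt) auto

lemma em_primitive_holomorphic: "x > 0 \<Longrightarrow> (\<lambda>s. em_primitive N s x) holomorphic_on (- {1})"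
  unfolding em_primitive_def
  by (intro holomorphic_on_sum holomorphic_on_mult holomorphic_on_const
      pow_deriv_holomorphic holomorphic_on_powr_right holomorphic_intros)

lemma em_remainder_holomorphic: "x > 0 \<Longrightarrow> (\<lambda>s. em_remainder N s x) holomorphic_on (- {1})"
  unfolding em_remainder_def
  by (intro holomorphic_on_diff em_primitive_holomorphic holomorphic_on_powr_right holomorphic_intros) auto

text \<open>
  Index \<open>0\<close> is left out: the majorant would be a power of zero there, and \<open>a\<close> may be smaller
  than \<open>1\<close>, so that \<open>a\<^bsup>-Re s\<^esup>\<close> is not monotone in the direction needed.
\<close>
lemma em_remainder_majorant:
  assumes "N \<ge> 1" "a > 0" "\<sigma> > 1 - real N"
  shows "\<exists>M. \<forall>s n. s \<noteq> 1 \<longrightarrow> Re s \<ge> \<sigma> \<longrightarrow> norm (pow_deriv (Suc N) s) \<le> K \<longrightarrow> n \<ge> 1 \<longrightarrow>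
           norm (em_remainder N s (real n + a)) \<le> M * real n powr (- \<sigma> - N)"
proof -
  obtain M where M: "M \<ge> 0" "\<And>s x. s \<noteq> 1 \<Longrightarrow> x > 0 \<Longrightarrow> Re s + N \<ge> 0 \<Longrightarrow>
    norm (em_remainder N s x) \<le> M * norm (pow_deriv (Suc N) s) * x powr (- Re s - N)"
    by (rule em_remainder_bound[of N]) (use assms in auto)
  show ?thesis
  proof (intro exI[of _ "M * K"] allI impI)
    fix s and n :: nat
    assume s: "s \<noteq> 1" "Re s \<ge> \<sigma>" "norm (pow_deriv (Suc N) s) \<le> K" and n: "n \<ge> 1"
    have "0 \<le> K"
      using order_trans[OF norm_ge_zero s(3)] .
    have "norm (em_remainder N s (real n + a)) \<le> M * norm (pow_deriv (Suc N) s) * (real n + a) powr (- Re s - N)"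
      using s n assms by (intro M) auto
    also have "\<dots> \<le> M * K * real n powr (- \<sigma> - N)"
    proof (intro mult_mono)
      have "(real n + a) powr (- Re s - N) \<le> real n powr (- Re s - N)"
        using n assms s by (intro powr_mono2') auto
      also have "\<dots> \<le> real n powr (- \<sigma> - N)"
        using n s by (intro powr_mono) auto
      finally show "(real n + a) powr (- Re s - N) \<le> real n powr (- \<sigma> - N)" .
    qed (use s M(1) \<open>0 \<le> K\<close> in auto)
    finally show "norm (em_remainder N s (real n + a)) \<le> M * K * real n powr (- \<sigma> - N)" .
  qed
qed

lemma em_remainder_uniform_limit:
  assumes "N \<ge> 1" "a > 0" "\<sigma> > 1 - real N"
    and S: "\<And>s. s \<in> S \<Longrightarrow> s \<noteq> 1 \<and> Re s \<ge> \<sigma> \<and> norm (pow_deriv (Suc N) s) \<le> K"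
  shows "uniform_limit S (\<lambda>k s. \<Sum>n<k. em_remainder N s (real n + a)) (\<lambda>s. \<Sum>n. em_remainder N s (real n + a)) sequentially"
proof -
  obtain M where M: "\<And>s n. s \<noteq> 1 \<Longrightarrow> Re s \<ge> \<sigma> \<Longrightarrow> norm (pow_deriv (Suc N) s) \<le> K \<Longrightarrow> n \<ge> 1 \<Longrightarrow>
           norm (em_remainder N s (real n + a)) \<le> M * real n powr (- \<sigma> - N)"
    using em_remainder_majorant[OF assms(1-3)] by blast
  show ?thesis
  proof (rule Weierstrass_m_test_ev)
    show "\<forall>\<^sub>F n in sequentially. \<forall>s\<in>S. norm (em_remainder N s (real n + a)) \<le> M * real n powr (- \<sigma> - N)"
      using eventually_ge_at_top[of 1] by eventually_elim (use S M in blast)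
    show "summable (\<lambda>n. M * real n powr (- \<sigma> - N))"
      using assms(3) by (intro summable_mult) (simp add: summable_real_powr_iff)
  qed
qed

lemma em_remainder_sums:
  assumes "N \<ge> 1" "a > 0" "s \<in> punctured_halfplane N"
  shows "(\<lambda>n. em_remainder N s (real n + a)) sums (\<Sum>n. em_remainder N s (real n + a))"
proof -
  have "uniform_limit {s} (\<lambda>k s. \<Sum>n<k. em_remainder N s (real n + a)) (\<lambda>s. \<Sum>n. em_remainder N s (real n + a)) sequentially"
    by (rule em_remainder_uniform_limit[OF assms(1,2), of "Re s"]) (use assms(3) in \<open>auto simp: punctured_halfplane_def\<close>)
  then show ?thesis
    unfolding sums_def by (rule tendsto_uniform_limitI) simp
qed

lemma hurwitz_em_holomorphic:
  assumes "N \<ge> 1" "a > 0"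
  shows "hurwitz_em N a holomorphic_on punctured_halfplane N"
proof -
  have sub: "punctured_halfplane N \<subseteq> - {1}" by (auto simp: punctured_halfplane_def)
  have "(\<lambda>s. \<Sum>n. em_remainder N s (real n + a)) holomorphic_on punctured_halfplane N"
  proof (rule holomorphic_uniform_sequence[OF open_punctured_halfplane])
    show "(\<lambda>s. \<Sum>n<k. em_remainder N s (real n + a)) holomorphic_on punctured_halfplane N" for k
      by (intro holomorphic_on_sum holomorphic_on_subset[OF em_remainder_holomorphic sub]) (use assms in auto)
  next
    fix s0 assume "s0 \<in> punctured_halfplane N"
    then obtain d where d: "d > 0" "cball s0 d \<subseteq> punctured_halfplane N"
      using open_contains_cball[of "punctured_halfplane N"] open_punctured_halfplane by blast
    have "continuous_on (cball s0 d) (pow_deriv (Suc N))"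
      by (rule holomorphic_on_imp_continuous_on, rule holomorphic_on_subset[OF pow_deriv_holomorphic])
         (use d sub in blast)
    then have "compact (pow_deriv (Suc N) ` cball s0 d)"
      by (rule compact_continuous_image) (rule compact_cball)
    then obtain K where K: "\<And>z. z \<in> pow_deriv (Suc N) ` cball s0 d \<Longrightarrow> norm z \<le> K"
      using compact_imp_bounded bounded_iff by metis
    have "s0 - of_real d \<in> cball s0 d"
      using d by (simp add: dist_norm)
    with d have "s0 - of_real d \<in> punctured_halfplane N" by blast
    then have \<sigma>: "Re s0 - d > 1 - real N" by (simp add: punctured_halfplane_def)
    have "uniform_limit (cball s0 d) (\<lambda>k s. \<Sum>n<k. em_remainder N s (real n + a))
            (\<lambda>s. \<Sum>n. em_remainder N s (real n + a)) sequentially"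
    proof (rule em_remainder_uniform_limit[OF assms \<sigma>])
      fix s assume s: "s \<in> cball s0 d"
      then have "\<bar>Re (s0 - s)\<bar> \<le> d"
        using abs_Re_le_cmod[of "s0 - s"] by (simp add: dist_norm)
      then show "s \<noteq> 1 \<and> Re s \<ge> Re s0 - d \<and> norm (pow_deriv (Suc N) s) \<le> K"
        using s d K sub by auto
    qed
    with d show "\<exists>d>0. cball s0 d \<subseteq> punctured_halfplane N \<and> uniform_limit (cball s0 d)
        (\<lambda>k s. \<Sum>n<k. em_remainder N s (real n + a)) (\<lambda>s. \<Sum>n. em_remainder N s (real n + a)) sequentially"
      by blast
  qed
  then have "(\<lambda>s. (\<Sum>n. em_remainder N s (real n + a)) - em_primitive N s a) holomorphic_on punctured_halfplane N"
    by (intro holomorphic_on_diff holomorphic_on_subset[OF em_primitive_holomorphic sub]) (use assms in auto)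
  then show ?thesis
    by (simp only: hurwitz_em_def[abs_def])
qed

lemma em_primitive_tendsto_0:
  assumes "Re s > 1" "a > 0"
  shows "(\<lambda>n. em_primitive N s (real n + a)) \<longlonglongrightarrow> 0"
proof -
  have "(\<lambda>n. of_real (real n + a) powr (1 - s - of_nat j) :: complex) \<longlonglongrightarrow> 0" for j
  proof (rule tendsto_neg_powr_complex_of_real)
    show "filterlim (\<lambda>n. real n + a) at_top sequentially"
      using filterlim_tendsto_add_at_top[OF tendsto_const filterlim_real_sequentially, of a]
      by (simp only: add.commute)
  qed (use assms in auto)
  then have "(\<lambda>n. \<Sum>j\<le>N. of_real (bern_coeff j) * pow_deriv j s * of_real (real n + a) powr (1 - s - of_nat j)) \<longlonglongrightarrow>
       (\<Sum>j\<le>N. of_real (bern_coeff j) * pow_deriv j s * 0)"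
    by (intro tendsto_sum tendsto_mult tendsto_const)
  then show ?thesis
    by (simp add: em_primitive_def)
qed

text \<open>
  To the right of \<open>1\<close> the forward differences of the primitive telescope to its value at \<open>a\<close>,
  since the primitive tends to zero at infinity.
\<close>
lemma hurwitz_em_sums:
  assumes "N \<ge> 1" "a > 0" "Re s > 1"
  shows "(\<lambda>n. of_real (real n + a) powr (- s)) sums hurwitz_em N a s"
proof -
  have "(\<lambda>n. em_primitive N s (real (Suc n) + a) - em_primitive N s (real n + a)) sums (0 - em_primitive N s (real 0 + a))"
    by (rule telescope_sums[OF em_primitive_tendsto_0[OF assms(3,2)]])
  moreover have "s \<in> punctured_halfplane N"
    using assms by (auto simp: punctured_halfplane_def)
  ultimately have "(\<lambda>n. em_remainder N s (real n + a) + (em_primitive N s (real (Suc n) + a) - em_primitive N s (real n + a)))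
      sums ((\<Sum>n. em_remainder N s (real n + a)) + (0 - em_primitive N s (real 0 + a)))"
    using assms by (intro sums_add em_remainder_sums) auto
  moreover have "em_remainder N s (real n + a) + (em_primitive N s (real (Suc n) + a) - em_primitive N s (real n + a)) =
      of_real (real n + a) powr (- s)" for n
  proof -
    have "real (Suc n) + a = real n + a + 1" by simp
    then show ?thesis by (simp only: em_remainder_def diff_add_cancel)
  qed
  ultimately show ?thesis
    by (simp add: hurwitz_em_def)
qed

text \<open>
  The punctured half-plane is connected, so the identity theorem compares every continuation
  with the one given by Euler-Maclaurin summation.
\<close>
lemma hurwitz_em_unique:
  assumes "N \<ge> 1" "a > 0" and s: "s \<in> punctured_halfplane N"
    and f: "f holomorphic_on punctured_halfplane N"
    and eq: "\<And>z. Re z > 1 \<Longrightarrow> (\<lambda>n. of_real (real n + a) powr (- z)) sums f z"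
  shows "f s = hurwitz_em N a s"
proof (rule analytic_continuation_open[of "{s. Re s > 1}" "punctured_halfplane N" f "hurwitz_em N a"])
  have "2 \<in> {s. Re s > 1}" by simp
  then show "{s. Re s > 1} \<noteq> {}" by blast
  show "{s. Re s > 1} \<subseteq> punctured_halfplane N"
    using assms(1) by (auto simp: punctured_halfplane_def)
  show "f z = hurwitz_em N a z" if "z \<in> {s. Re s > 1}" for z
  proof -
    have "Re z > 1" using that by simp
    from sums_unique2[OF eq[OF this] hurwitz_em_sums[OF assms(1,2) this]] show ?thesis .
  qed
  show "hurwitz_em N a holomorphic_on punctured_halfplane N"
    by (rule hurwitz_em_holomorphic[OF assms(1,2)])
qed (fact open_halfspace_Re_gt open_punctured_halfplane connected_punctured_halfplane f s)+

text \<open>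
  The continuations to growing half-planes agree on overlaps. They are glued by choosing at
  each \<open>s\<close> some \<open>N\<close> with \<open>Re s > 1 - N\<close>.
\<close>
lemma hurwitz_zeta_exists:
  assumes "a > 0"
  shows "\<exists>f. f holomorphic_on (- {1}) \<and>
        (\<forall>z. Re z > 1 \<longrightarrow> (\<lambda>n. of_real (real n + a) powr (- z)) sums f z)"
proof -
  define f where "f s = hurwitz_em (Suc (nat \<lceil>1 - Re s\<rceil>)) a s" for s
  have mono: "punctured_halfplane N \<subseteq> punctured_halfplane N'" if "N \<le> N'" for N N'
    using that by (auto simp: punctured_halfplane_def)
  have dom: "s \<in> punctured_halfplane (Suc (nat \<lceil>1 - Re s\<rceil>))" if "s \<noteq> 1" for s
  proof -
    have "1 - Re s \<le> real (nat \<lceil>1 - Re s\<rceil>)" by (rule real_nat_ceiling_ge)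
    then show ?thesis using that by (simp add: punctured_halfplane_def)
  qed
  have eq: "hurwitz_em N' a s = hurwitz_em N a s" if "N \<ge> 1" "N \<le> N'" "s \<in> punctured_halfplane N" for N N' s
  proof (rule hurwitz_em_unique[OF that(1) assms that(3)])
    show "hurwitz_em N' a holomorphic_on punctured_halfplane N"
      by (rule holomorphic_on_subset[OF hurwitz_em_holomorphic mono]) (use that assms in auto)
    show "(\<lambda>n. of_real (real n + a) powr (- z)) sums hurwitz_em N' a z" if "Re z > 1" for z
      using that \<open>N \<ge> 1\<close> \<open>N \<le> N'\<close> assms by (intro hurwitz_em_sums) auto
  qed
  have f_eq: "f s = hurwitz_em (Suc N) a s" if "s \<in> punctured_halfplane (Suc N)" for N s
  proof -
    have "s \<noteq> 1" using that by (auto simp: punctured_halfplane_def)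
    show ?thesis
    proof (cases "Suc N \<le> Suc (nat \<lceil>1 - Re s\<rceil>)")
      case True
      then show ?thesis
        unfolding f_def using eq[OF _ True that] by simp
    next
      case False
      then have le: "Suc (nat \<lceil>1 - Re s\<rceil>) \<le> Suc N" by (simp only: not_le less_imp_le)
      show ?thesis
        unfolding f_def by (rule eq[OF _ le dom[OF \<open>s \<noteq> 1\<close>], symmetric]) simp
    qed
  qed
  have "f holomorphic_on (\<Union>N\<in>UNIV. punctured_halfplane (Suc N))"
  proof (rule holomorphic_on_UN_open)
    show "f holomorphic_on punctured_halfplane (Suc N)" for N
      using hurwitz_em_holomorphic[of "Suc N" a] assms holomorphic_cong[OF refl f_eq] by simp
  qed (rule open_punctured_halfplane)
  moreover have "- {1} \<subseteq> (\<Union>N\<in>UNIV. punctured_halfplane (Suc N))"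
    using dom by blast
  ultimately have "f holomorphic_on - {1}"
    by (rule holomorphic_on_subset)
  moreover have "(\<lambda>n. of_real (real n + a) powr (- z)) sums f z" if "Re z > 1" for z
    unfolding f_def using that assms by (intro hurwitz_em_sums) auto
  ultimately show ?thesis by blast
qed

lemma hurwitz_zeta_eq_hurwitz_em:
  assumes "N \<ge> 1" "a > 0" "s \<in> punctured_halfplane N"
  shows "hurwitz_zeta s a = hurwitz_em N a s"
proof -
  define f where "f = (SOME f. f holomorphic_on (- {1}) \<and>
        (\<forall>z. Re z > 1 \<longrightarrow> (\<lambda>n. of_real (real n + a) powr (- z)) sums f z))"
  have f: "f holomorphic_on (- {1})" "\<And>z. Re z > 1 \<Longrightarrow> (\<lambda>n. of_real (real n + a) powr (- z)) sums f z"
    using someI_ex[OF hurwitz_zeta_exists[OF assms(2)]] unfolding f_def[symmetric] by blast+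
  have "f s = hurwitz_em N a s"
  proof (rule hurwitz_em_unique[OF assms])
    show "f holomorphic_on punctured_halfplane N"
      using f(1) by (rule holomorphic_on_subset) (auto simp: punctured_halfplane_def)
  qed (rule f(2))
  then show ?thesis
    by (simp add: hurwitz_zeta_def f_def)
qed

theorem hurwitz_zeta_neg_nat:
  assumes "a > 0"
  shows "hurwitz_zeta (- of_nat m) a = - fact m * bern (Suc m) (of_real a)"
proof -
  let ?N = "Suc (Suc m)"
  have "hurwitz_zeta (- of_nat m) a = hurwitz_em ?N a (- of_nat m)"
    using neg_of_nat_neq_1[of m] by (intro hurwitz_zeta_eq_hurwitz_em assms) (auto simp: punctured_halfplane_def)
  also have "\<dots> = - em_primitive ?N (- of_nat m) a"
    using assms by (simp add: hurwitz_em_def em_remainder_neg_nat)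
  also have "em_primitive ?N (- of_nat m) a =
      (\<Sum>j\<le>Suc m. of_real (bern_coeff j) * pow_deriv j (- of_nat m) * of_real a powr (1 - - of_nat m - of_nat j))"
    unfolding em_primitive_def by (simp add: pow_deriv_neg_nat del: pow_deriv.simps)
  also have "\<dots> = (\<Sum>j\<le>Suc m. fact m * (of_real (bern_coeff j) * of_real a ^ (Suc m - j) / fact (Suc m - j)))"
  proof (intro sum.cong refl)
    fix j assume "j \<in> {..Suc m}"
    then have j: "j \<le> Suc m" by simp
    then have "1 - - of_nat m - of_nat j = (of_nat (Suc m - j) :: complex)"
      by (simp add: of_nat_diff)
    then have "of_real a powr (1 - - of_nat m - of_nat j) = (of_real a ^ (Suc m - j) :: complex)"
      using assms by (simp only: powr_complexpow of_real_eq_0_iff)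
    with j show "of_real (bern_coeff j) * pow_deriv j (- of_nat m) * of_real a powr (1 - - of_nat m - of_nat j)
        = fact m * (of_real (bern_coeff j) * of_real a ^ (Suc m - j) / fact (Suc m - j))"
      by (simp only: pow_deriv_neg_nat if_True) (simp only: times_divide_eq_left times_divide_eq_right mult_ac)
  qed
  also have "\<dots> = fact m * bern (Suc m) (of_real a)"
    by (simp only: bern_def sum_distrib_left)
  finally show ?thesis by simp
qed

section \<open>Fourier series of the Bernoulli polynomials\<close>

text \<open>
  The Fourier series \<open>- \<Sum>\<^bsub>m\<noteq>0\<^esub> e\<^bsup>2\<pi>imt\<^esup> / (2\<pi>im)\<^bsup>n\<^esup>\<close> of \<open>B_n(t) / n!\<close> in real form. The phase
  \<open>n \<pi> / 2\<close> treats sine and cosine series alike, so that differentiation only shifts \<open>n\<close>.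
\<close>
definition bern_fourier :: "nat \<Rightarrow> real \<Rightarrow> real" where
  "bern_fourier n t =
     (\<Sum>m. - 2 * cos (2 * pi * real (Suc m) * t - real n * pi / 2) / (2 * pi * real (Suc m)) ^ n)"

lemma bern_fourier_term_bound:
  assumes "n \<ge> 2"
  shows "norm (- 2 * cos (2 * pi * real (Suc m) * t - real n * pi / 2) / (2 * pi * real (Suc m)) ^ n)
           \<le> 2 / real (Suc m) ^ 2"
proof -
  have "real (Suc m) ^ 2 \<le> (2 * pi * real (Suc m)) ^ 2"
    using pi_gt3 by (intro power_mono) auto
  also have "\<dots> \<le> (2 * pi * real (Suc m)) ^ n"
  proof (rule power_increasing[OF assms])
    have "1 * 1 \<le> (2 * pi) * real (Suc m)"
      using pi_gt3 by (intro mult_mono) auto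
    then show "1 \<le> 2 * pi * real (Suc m)" by simp
  qed
  finally have "real (Suc m) ^ 2 \<le> (2 * pi * real (Suc m)) ^ n" .
  then have "2 * \<bar>cos (2 * pi * real (Suc m) * t - real n * pi / 2)\<bar> / (2 * pi * real (Suc m)) ^ n
               \<le> (2 * 1) / real (Suc m) ^ 2"
    by (intro frac_le mult_left_mono) auto
  then show ?thesis
    by (simp add: abs_mult power_abs)
qed

lemma summable_inverse_squares: "summable (\<lambda>m. 2 / real (Suc m) ^ 2)"
  using summable_mult[OF sums_summable[OF inverse_squares_sums], of 2] by simp

lemma bern_fourier_sums:
  assumes "n \<ge> 2"
  shows "(\<lambda>m. - 2 * cos (2 * pi * real (Suc m) * t - real n * pi / 2) / (2 * pi * real (Suc m)) ^ n)
           sums bern_fourier n t"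
  unfolding bern_fourier_def
  by (intro summable_sums summable_comparison_test'[OF summable_inverse_squares]
      bern_fourier_term_bound assms)

lemma bern_fourier_uniform_limit:
  assumes "n \<ge> 2"
  shows "uniform_limit S (\<lambda>N t. \<Sum>m<N. - 2 * cos (2 * pi * real (Suc m) * t - real n * pi / 2)
            / (2 * pi * real (Suc m)) ^ n) (bern_fourier n) sequentially"
  unfolding bern_fourier_def[abs_def]
  by (rule Weierstrass_m_test[OF bern_fourier_term_bound[OF assms] summable_inverse_squares])

lemma bern_fourier_periodic: "bern_fourier n 1 = bern_fourier n 0"
proof -
  have "cos (2 * pi * real (Suc m) - real n * pi / 2) = cos (- (real n * pi / 2))" for m
  proof -
    have "cos (2 * pi * real (Suc m) - real n * pi / 2) = 
        cos (2 * pi * real (Suc m)) * cos (real n * pi / 2) + sin (2 * pi * real (Suc m)) * sin (real n * pi / 2)"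
      by (rule cos_diff)
    also have "2 * pi * real (Suc m) = 2 * real (Suc m) * pi" by simp
    finally show ?thesis
      using cos_int_2pin[of "int (Suc m)"] sin_int_2pin[of "int (Suc m)"] by (simp add: mult_ac)
  qed
  then show ?thesis
    by (simp add: bern_fourier_def)
qed

lemma has_field_derivative_bern_fourier:
  assumes "n \<ge> 2" and "t \<in> {0..1}"
  shows "(bern_fourier (Suc n) has_field_derivative bern_fourier n t) (at t within {0..1})"
proof -
  let ?f = "\<lambda>n m t. - 2 * cos (2 * pi * real (Suc m) * t - real n * pi / 2) / (2 * pi * real (Suc m)) ^ n"
  have deriv: "(?f (Suc n) m has_field_derivative ?f n m t) (at t within {0..1})" for m t
  proof -
    have cs: "cos (2 * pi * real (Suc m) * t - real n * pi / 2) =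
          - sin (2 * pi * real (Suc m) * t - real (Suc n) * pi / 2)"
    proof -
      have "2 * pi * real (Suc m) * t - real n * pi / 2 =
          (2 * pi * real (Suc m) * t - real (Suc n) * pi / 2) + pi / 2"
        by (simp add: field_simps)
      then show ?thesis
        by (metis cos_add cos_pi_half sin_pi_half mult_zero_right mult_1_right diff_0)
    qed
    show ?thesis
      unfolding cs by (auto intro!: derivative_eq_intros simp del: of_nat_Suc)
  qed
  obtain g where g: "\<forall>t\<in>{0..1}. (\<lambda>m. ?f (Suc n) m t) sums g t \<and>
      (g has_field_derivative bern_fourier n t) (at t within {0..1})"
    using has_field_derivative_series[OF convex_closed_interval deriv
        bern_fourier_uniform_limit[OF assms(1)] assms(2) sums_summable[OF bern_fourier_sums]] assms(1)
    by auto
  have eq: "g t = bern_fourier (Suc n) t" if "t \<in> {0..1}" for t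
    by (rule sums_unique2[OF _ bern_fourier_sums]) (use g that assms(1) in auto)
  show ?thesis
    by (rule has_field_derivative_transform_within[of g _ _ _ 1]) (use g eq assms in auto)
qed

text \<open>
  If the two functions of index \<open>n\<close> differ by \<open>c\<close>, then those of index \<open>n + 1\<close> differ by
  \<open>c t + d\<close>; as each of them takes the same value at \<open>0\<close> and at \<open>1\<close>, \<open>c = 0\<close>. Thus the
  statement up to a constant passes from \<open>n\<close> to \<open>n + 1\<close>, and the constant itself is zero.
\<close>
lemma bern_eq_bern_fourier_upto_const:
  assumes "n \<ge> 2" and "\<And>t. t \<in> {0..1} \<Longrightarrow> bern n t = bern_fourier n t + c"
  shows "c = 0" and "\<exists>c'. \<forall>t\<in>{0..1}. bern (Suc n) t = bern_fourier (Suc n) t + c'"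
proof -
  have "((\<lambda>t. bern (Suc n) t - bern_fourier (Suc n) t - c * t) has_field_derivative 0)
          (at t within {0..1})" if "t \<in> {0..1}" for t
    using DERIV_diff[OF DERIV_diff[OF has_field_derivative_bern[of n]
        has_field_derivative_bern_fourier[OF assms(1) that]] DERIV_cmult_Id[of c]]
    by (simp add: assms(2)[OF that])
  then obtain d where d: "\<And>t. t \<in> {0..1} \<Longrightarrow> bern (Suc n) t - bern_fourier (Suc n) t - c * t = d"
    using has_field_derivative_zero_constant[of "{0..1::real}"
        "\<lambda>t. bern (Suc n) t - bern_fourier (Suc n) t - c * t"] by auto
  show "c = 0"
    using d[of 0] d[of 1] assms(1) bern_fourier_periodic[of "Suc n"]
    by (simp add: bern_at_1)
  then show "\<exists>c'. \<forall>t\<in>{0..1}. bern (Suc n) t = bern_fourier (Suc n) t + c'"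
    using d by (intro exI[of _ d]) (auto simp: algebra_simps)
qed

text \<open>
  The dilogarithm on the closed unit disc. Its real part on the unit circle is, up to a
  factor, the Fourier series of \<open>B_2\<close>. The series of derivatives converges only
  conditionally, so it is not differentiated there term by term; radial limits from inside
  the disc replace this.
\<close>
definition dilog :: "complex \<Rightarrow> complex" where
  "dilog z = (\<Sum>n. z ^ Suc n / of_nat (Suc n) ^ 2)"

lemma dilog_term_bound: "norm z \<le> 1 \<Longrightarrow> norm (z ^ Suc n / of_nat (Suc n) ^ 2 :: complex) \<le> 2 / real (Suc n) ^ 2"
proof -
  assume "norm z \<le> 1"
  then have "norm z ^ Suc n \<le> 1" by (intro power_le_one) auto
  then have "norm z ^ Suc n / real (Suc n) ^ 2 \<le> 2 / real (Suc n) ^ 2"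
    by (intro divide_right_mono) auto
  then show ?thesis by (simp add: norm_divide norm_power norm_mult del: of_nat_Suc)
qed

lemma dilog_sums: "norm z \<le> 1 \<Longrightarrow> (\<lambda>n. z ^ Suc n / of_nat (Suc n) ^ 2) sums dilog z"
  unfolding dilog_def
  by (intro summable_sums summable_comparison_test'[OF summable_inverse_squares])
     (use dilog_term_bound in auto)

lemma continuous_on_dilog: "continuous_on (cball 0 1) dilog"
proof (rule uniform_limit_theorem)
  show "uniform_limit (cball 0 1) (\<lambda>N z. \<Sum>n<N. z ^ Suc n / of_nat (Suc n) ^ 2) dilog sequentially"
    unfolding dilog_def[abs_def]
    by (rule Weierstrass_m_test[OF _ summable_inverse_squares]) (use dilog_term_bound in auto)
qed (auto intro!: always_eventually continuous_intros simp del: of_nat_Suc)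

lemma has_field_derivative_dilog:
  assumes "norm z < 1"
  shows "\<exists>D. (dilog has_field_derivative D) (at z) \<and> z * D = - Ln (1 - z)"
proof -
  define D where "D = (\<Sum>n. diffs (\<lambda>n. if n = 0 then 0 else 1 / of_nat n ^ 2) n * z ^ n)"
  let ?c = "\<lambda>n. if n = 0 then 0 else 1 / of_nat n ^ 2 :: complex"
  have sums: "(\<lambda>n. ?c n * w ^ n) sums dilog w" if "norm w < 1" for w
  proof (rule sums_Suc_imp)
    show "(\<lambda>n. ?c (Suc n) * w ^ Suc n) sums dilog w"
      using dilog_sums[of w] that by simp
  qed simp
  have "((\<lambda>w. \<Sum>n. ?c n * w ^ n) has_field_derivative D) (at z)"
    unfolding D_def
    by (rule termdiffs_strong'[of 1]) (use sums assms in \<open>auto simp: sums_iff\<close>)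
  then have "(dilog has_field_derivative D) (at z)"
  proof (rule has_field_derivative_transform_within_open[of _ _ _ "ball 0 1"])
  qed (use sums assms in \<open>auto simp: sums_iff\<close>)
  moreover have "z * D = - Ln (1 - z)"
  proof -
    have "(\<lambda>n. diffs ?c n * z ^ n) sums D"
      unfolding D_def
      by (intro summable_sums termdiff_converges[of _ 1]) (use sums assms in \<open>auto simp: sums_iff\<close>)
    then have D: "(\<lambda>n. z * (diffs ?c n * z ^ n)) sums (z * D)"
      by (rule sums_mult)
    have "(\<lambda>n. (- 1) ^ Suc n / of_nat n * (- z) ^ n) sums ln (1 + (- z))"
      using assms by (intro Ln_series) auto
    then have "(\<lambda>n. (- 1) ^ Suc (Suc n) / of_nat (Suc n) * (- z) ^ Suc n) sums Ln (1 - z)"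
      by (subst sums_Suc_iff) simp
    then have "(\<lambda>n. - ((- 1) ^ Suc (Suc n) / of_nat (Suc n) * (- z) ^ Suc n)) sums - Ln (1 - z)"
      by (rule sums_minus)
    moreover have "z * (diffs ?c n * z ^ n) = - ((- 1) ^ Suc (Suc n) / of_nat (Suc n) * (- z) ^ Suc n)" for n
      by (simp add: diffs_def power2_eq_square power_minus[of z] divide_simps del: of_nat_Suc)
    ultimately show ?thesis
      using D by (simp only: sums_unique2)
  qed
  ultimately show ?thesis by blast
qed

lemma cos_2pi_less_1:
  assumes "0 < t" "t < 1" shows "cos (2 * pi * t) < 1"
proof -
  have "sin (pi * t) > 0"
    using assms by (intro sin_gt_zero) auto
  then show ?thesis
    using cos_double_sin[of "pi * t"] by (simp add: mult_ac)
qed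

text \<open>
  Up to sign, this is the closed form of the sawtooth series \<open>\<Sum> sin (2\<pi>mt) / m\<close>, read off
  from \<open>1 - e\<^bsup>2\<pi>it\<^esup> = 2 sin (\<pi>t) e\<^bsup>i(\<pi>t-\<pi>/2)\<^esup>\<close>.
\<close>
lemma Ln_one_minus_circle:
  assumes "0 < t" "t < 1"
  shows "Im (Ln (1 - cis (2 * pi * t))) = pi * (t - 1 / 2)"
proof -
  have pos: "sin (pi * t) > 0"
    using assms by (intro sin_gt_zero) auto
  define w where "w = Complex (ln (2 * sin (pi * t))) (pi * (t - 1 / 2))"
  have "exp w = of_real (2 * sin (pi * t)) * cis (pi * t - pi / 2)"
    using pos by (simp add: w_def exp_eq_polar algebra_simps)
  also have "\<dots> = 1 - cis (2 * (pi * t))"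
    by (simp add: complex_eq_iff cos_diff sin_diff sin_double cos_double_sin power2_eq_square)
  finally have "exp w = 1 - cis (2 * pi * t)"
    by (simp only: mult.assoc)
  moreover have "- pi < Im w" "Im w \<le> pi"
  proof -
    have "pi * (- 1) < pi * (t - 1 / 2)" "pi * (t - 1 / 2) \<le> pi * 1"
      using assms by (intro mult_strict_left_mono mult_left_mono; simp)+
    then show "- pi < Im w" "Im w \<le> pi" by (simp_all add: w_def)
  qed
  ultimately have "Ln (1 - cis (2 * pi * t)) = w"
    by (metis Ln_exp)
  then show ?thesis by (simp add: w_def)
qed

text \<open>
  The function is continuous, hence uniformly continuous, on the compact set \<open>[0,1] \<times> [a,b]\<close>
  of polar coordinates: away from \<open>z = 1\<close> the number \<open>1 - z\<close> stays off the branch cut.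
\<close>
lemma Im_Ln_near_circle:
  assumes "0 < a" "b < 1" "e > 0"
  shows "\<exists>d>0. \<forall>r t. 1 - d < r \<longrightarrow> r < 1 \<longrightarrow> t \<in> {a..b} \<longrightarrow>
           \<bar>Im (Ln (1 - of_real r * cis (2 * pi * t))) - pi * (t - 1 / 2)\<bar> < e"
proof -
  define \<Phi> where "\<Phi> = (\<lambda>p. Im (Ln (1 - of_real (fst p) * cis (2 * pi * snd p))) - pi * (snd p - 1 / 2))"
  have "1 - of_real r * cis (2 * pi * t) \<notin> \<real>\<^sub>\<le>\<^sub>0" if "r \<in> {0..1}" "t \<in> {a..b}" for r t
  proof -
    have "r * cos (2 * pi * t) < 1"
    proof (cases "r = 0")
      case False
      then have "r * cos (2 * pi * t) < r * 1"
        using that assms by (intro mult_strict_left_mono cos_2pi_less_1) auto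
      then show ?thesis using that by simp
    qed simp
    then show ?thesis
      by (auto simp: complex_nonpos_Reals_iff Re_exp mult_ac)
  qed
  then have "continuous_on ({0..1} \<times> {a..b}) \<Phi>"
    unfolding \<Phi>_def by (intro continuous_intros) auto
  then have "uniformly_continuous_on ({0..1} \<times> {a..b}) \<Phi>"
    by (intro compact_uniformly_continuous compact_Times) auto
  then obtain d where d: "d > 0"
    "\<And>p q. p \<in> {0..1} \<times> {a..b} \<Longrightarrow> q \<in> {0..1} \<times> {a..b} \<Longrightarrow> dist q p < d \<Longrightarrow> dist (\<Phi> q) (\<Phi> p) < e"
    using \<open>e > 0\<close> unfolding uniformly_continuous_on_def by metis
  show ?thesis
  proof (intro exI[of _ "min d 1"] conjI allI impI)
    fix r t assume r: "1 - min d 1 < r" "r < 1" and t: "t \<in> {a..b}"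
    have "dist (\<Phi> (r, t)) (\<Phi> (1, t)) < e"
      using r t by (intro d) (auto simp: dist_Pair_Pair dist_real_def)
    moreover have "\<Phi> (1, t) = 0"
      using Ln_one_minus_circle[of t] t assms by (simp add: \<Phi>_def)
    ultimately show "\<bar>Im (Ln (1 - of_real r * cis (2 * pi * t))) - pi * (t - 1 / 2)\<bar> < e"
      by (simp add: \<Phi>_def)
  qed (use d in auto)
qed

lemma has_real_derivative_Re_dilog:
  assumes "0 \<le> r" "r < 1"
  shows "((\<lambda>t. Re (dilog (of_real r * cis (2 * pi * t)))) has_real_derivative
            2 * pi * Im (Ln (1 - of_real r * cis (2 * pi * t)))) (at t)"
proof -
  define z where "z = of_real r * cis (2 * pi * t)"
  have "norm z < 1"
    using assms by (simp add: z_def norm_mult)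
  then obtain D where D: "(dilog has_field_derivative D) (at z)" "z * D = - Ln (1 - z)"
    using has_field_derivative_dilog by blast
  have "((\<lambda>t. of_real r * cis (2 * pi * t)) has_vector_derivative of_real (2 * pi) * \<i> * z) (at t)"
  proof -
    have "((\<lambda>t. 2 * pi * t) has_derivative (\<lambda>x. 2 * pi * x)) (at t)"
      by (intro has_derivative_mult_right has_derivative_ident)
    from has_derivative_mult_right[OF has_derivative_cis[OF this], of "of_real r"]
    have "((\<lambda>t. of_real r * cis (2 * pi * t)) has_derivative
        (\<lambda>x. of_real r * ((2 * pi * x) *\<^sub>R (\<i> * cis (2 * pi * t))))) (at t)" .
    moreover have "(\<lambda>x. of_real r * ((2 * pi * x) *\<^sub>R (\<i> * cis (2 * pi * t)))) =
        (\<lambda>x. x *\<^sub>R (of_real (2 * pi) * \<i> * z))"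
      unfolding z_def scaleR_conv_of_real of_real_mult by (intro ext) (simp only: mult_ac)
    ultimately show ?thesis
      unfolding has_vector_derivative_def by (simp only:)
  qed
  from field_vector_diff_chain_at[OF this D(1)[unfolded z_def]]
  have "((\<lambda>t. dilog (of_real r * cis (2 * pi * t))) has_vector_derivative of_real (2 * pi) * \<i> * z * D) (at t)"
    unfolding o_def .
  then have "((\<lambda>t. Re (dilog (of_real r * cis (2 * pi * t)))) has_vector_derivative
        Re (of_real (2 * pi) * \<i> * z * D)) (at t)"
    by (rule bounded_linear.has_vector_derivative[OF bounded_linear_Re])
  moreover have "Re (of_real (2 * pi) * \<i> * z * D) = 2 * pi * Im (Ln (1 - z))"
  proof -
    have "Re (of_real (2 * pi) * \<i> * (- w)) = 2 * pi * Im w" for w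
      by simp
    then show ?thesis
      by (simp only: mult.assoc[of _ z] D(2))
  qed
  ultimately show ?thesis
    unfolding has_real_derivative_iff_has_vector_derivative z_def by (simp only:)
qed

text \<open>
  On a circle of radius \<open>r < 1\<close> the derivative of the difference is \<open>2\<pi>\<close> times the quantity
  that \<open>Im_Ln_near_circle\<close> makes uniformly small, so the increment from \<open>a\<close> to \<open>b\<close> tends to
  zero as \<open>r\<close> tends to \<open>1\<close>.
\<close>
lemma Re_dilog_circle_const:
  assumes "0 < a" "a \<le> b" "b < 1"
  shows "Re (dilog (cis (2 * pi * b))) - pi\<^sup>2 * (b\<^sup>2 - b) =
         Re (dilog (cis (2 * pi * a))) - pi\<^sup>2 * (a\<^sup>2 - a)"
proof -
  define F where "F = (\<lambda>r t. Re (dilog (of_real r * cis (2 * pi * t))) - pi\<^sup>2 * (t\<^sup>2 - t))"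
  have "continuous_on {0..1} (\<lambda>r. F r t)" for t
  proof -
    have "continuous_on {0..1} (\<lambda>r. dilog (of_real r * cis (2 * pi * t)))"
    proof (rule continuous_on_compose2[OF continuous_on_dilog])
      show "continuous_on {0..1} (\<lambda>r. of_real r * cis (2 * pi * t))"
        by (intro continuous_intros)
      show "(\<lambda>r. of_real r * cis (2 * pi * t)) ` {0..1} \<subseteq> cball 0 1"
        by (auto simp: norm_mult)
    qed
    then show ?thesis
      unfolding F_def by (intro continuous_on_diff continuous_on_Re continuous_on_const)
  qed
  then have lim: "((\<lambda>r. F r t) \<longlongrightarrow> F 1 t) (at_left 1)" for t
    using continuous_on_Icc_at_leftD[of 0 1 "\<lambda>r. F r t"] by simp
  have "((\<lambda>r. F r b - F r a) \<longlongrightarrow> 0) (at_left 1)"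
  proof (rule tendstoI)
    fix e :: real assume "e > 0"
    then have "e / (4 * pi) > 0" by simp
    then obtain d where d: "d > 0" "\<And>r t. 1 - d < r \<Longrightarrow> r < 1 \<Longrightarrow> t \<in> {a..b} \<Longrightarrow>
        \<bar>Im (Ln (1 - of_real r * cis (2 * pi * t))) - pi * (t - 1 / 2)\<bar> < e / (4 * pi)"
      using Im_Ln_near_circle[OF assms(1,3)] by meson
    have "dist (F r b - F r a) 0 < e" if r: "max 0 (1 - d) < r" "r < 1" for r
    proof -
      have "norm (F r b - F r a) \<le> e / 2 * norm (b - a)"
      proof (rule field_differentiable_bound[of "{a..b}" "F r"
            "\<lambda>t. 2 * pi * (Im (Ln (1 - of_real r * cis (2 * pi * t))) - pi * (t - 1 / 2))"])
        fix t assume t: "t \<in> {a..b}"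
        show "(F r has_field_derivative
            2 * pi * (Im (Ln (1 - of_real r * cis (2 * pi * t))) - pi * (t - 1 / 2))) (at t within {a..b})"
        proof -
          have A: "((\<lambda>t. pi\<^sup>2 * (t\<^sup>2 - t)) has_real_derivative pi\<^sup>2 * (2 * t - 1)) (at t within {a..b})"
            by (auto intro!: derivative_eq_intros)
          have B: "((\<lambda>t. Re (dilog (of_real r * cis (2 * pi * t)))) has_real_derivative
              2 * pi * Im (Ln (1 - of_real r * cis (2 * pi * t)))) (at t within {a..b})"
            using r by (intro has_field_derivative_at_within[OF has_real_derivative_Re_dilog]) auto
          have "2 * pi * Im (Ln (1 - of_real r * cis (2 * pi * t))) - pi\<^sup>2 * (2 * t - 1) =
              2 * pi * (Im (Ln (1 - of_real r * cis (2 * pi * t))) - pi * (t - 1 / 2))"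
            by (simp add: algebra_simps power2_eq_square)
          with DERIV_diff[OF B A] show ?thesis
            unfolding F_def by (simp only:)
        qed
        have "norm (2 * pi * (Im (Ln (1 - of_real r * cis (2 * pi * t))) - pi * (t - 1 / 2)))
            \<le> 2 * pi * (e / (4 * pi))"
          unfolding norm_mult using less_imp_le[OF d(2)[OF _ r(2) t]] r by (intro mult_mono) auto
        then show "norm (2 * pi * (Im (Ln (1 - of_real r * cis (2 * pi * t))) - pi * (t - 1 / 2))) \<le> e / 2"
          by simp
      qed (use assms in auto)
      also have "\<dots> \<le> e / 2 * 1"
        using assms \<open>e > 0\<close> by (intro mult_left_mono) auto
      finally show ?thesis using \<open>e > 0\<close> by simp
    qed
    moreover have "\<forall>\<^sub>F r in at_left 1. r \<in> {max 0 (1 - d)<..<1}"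
      by (rule eventually_at_left_real) (use d(1) in auto)
    ultimately show "\<forall>\<^sub>F r in at_left 1. dist (F r b - F r a) 0 < e"
      by (auto elim: eventually_mono)
  qed
  with tendsto_diff[OF lim[of b] lim[of a]] have "F 1 b - F 1 a = 0"
    by (rule tendsto_unique[rotated]) simp
  then show ?thesis
    by (simp add: F_def)
qed

lemma bern_fourier_2_dilog: "bern_fourier 2 t = Re (dilog (cis (2 * pi * t))) / (2 * pi\<^sup>2)"
proof -
  have "(\<lambda>m. Re (cis (2 * pi * t) ^ Suc m / of_nat (Suc m) ^ 2) / (2 * pi\<^sup>2)) sums
          (Re (dilog (cis (2 * pi * t))) / (2 * pi\<^sup>2))"
    by (intro sums_divide sums_Re dilog_sums) simp
  moreover have "Re (cis (2 * pi * t) ^ Suc m / of_nat (Suc m) ^ 2) / (2 * pi\<^sup>2) =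
      - 2 * cos (2 * pi * real (Suc m) * t - real 2 * pi / 2) / (2 * pi * real (Suc m)) ^ 2" for m
  proof -
    define k where "k = real (Suc m)"
    have "cis (2 * pi * t) ^ Suc m = cis (2 * pi * k * t)"
      by (subst Complex.DeMoivre) (auto simp: mult_ac k_def)
    moreover have "of_nat (Suc m) ^ 2 = (of_real (k ^ 2) :: complex)"
      by (simp add: k_def)
    ultimately have "Re (cis (2 * pi * t) ^ Suc m / of_nat (Suc m) ^ 2) = cos (2 * pi * k * t) / k ^ 2"
      by (simp only: Re_divide_of_real cis.sel)
    moreover have "cos (x - real 2 * pi / 2) = - cos x" for x
      by (simp add: cos_diff)
    ultimately show ?thesis
      unfolding k_def[symmetric] by (simp add: power_mult_distrib)
  qed
  ultimately show ?thesis
    using sums_unique2[OF bern_fourier_sums[of 2 t]] by (simp only:)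
qed

text \<open>
  The endpoints are reached by continuity only, since the logarithm has its singularity
  there.
\<close>
lemma bern_2_upto_const: "\<exists>c. \<forall>t\<in>{0..1}. bern 2 t = bern_fourier 2 t + c"
proof -
  define F where "F t = bern 2 t - bern_fourier 2 t" for t :: real
  have eq: "F t = F (1 / 2)" if "t \<in> {0<..<1}" for t
  proof -
    have bern_2: "bern 2 t = t\<^sup>2 / 2 - t / 2 + bern_coeff 2" for t :: real
      by (simp add: bern_def numeral_2_eq_2 bern_coeff_0 bern_coeff_1)
    define G where "G = (\<lambda>t. Re (dilog (cis (2 * pi * t))) - pi\<^sup>2 * (t\<^sup>2 - t))"
    have "t\<^sup>2 / 2 - t / 2 + c - X / (2 * p) = - (X - p * (t\<^sup>2 - t)) / (2 * p) + c" if "p \<noteq> 0" for t c X p :: real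
      using that by (simp add: field_simps)
    from this[of "pi\<^sup>2"] have F: "F t = - G t / (2 * pi\<^sup>2) + bern_coeff 2" for t
      unfolding F_def G_def bern_2 bern_fourier_2_dilog by simp
    have "G t = G (1 / 2)"
    proof (cases "t \<le> 1 / 2")
      case True
      show ?thesis
        unfolding G_def by (rule Re_dilog_circle_const[symmetric]) (use True that in auto)
    next
      case False
      show ?thesis
        unfolding G_def by (rule Re_dilog_circle_const) (use False that in auto)
    qed
    then show ?thesis
      by (simp only: F)
  qed
  have "continuous_on {0..1} F"
    unfolding F_def[abs_def]
  proof (intro continuous_on_diff)
    show "continuous_on {0..1} (bern 2 :: real \<Rightarrow> real)"
      unfolding bern_def by (intro continuous_intros) auto
    show "continuous_on {0..1} (bern_fourier 2)"
      by (rule uniform_limit_theorem[OF _ bern_fourier_uniform_limit])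
         (auto intro!: always_eventually continuous_intros simp del: of_nat_Suc)
  qed
  have const: "F t = F (1 / 2)" if "t \<in> {0..1}" for t
  proof (rule continuous_constant_on_closure[of "{0<..<1::real}" F])
    show "continuous_on (closure {0<..<1}) F" "t \<in> closure {0<..<1}"
      using \<open>continuous_on {0..1} F\<close> that by simp_all
  qed (rule eq)
  show ?thesis
  proof (intro exI[of _ "F (1 / 2)"] ballI)
    fix t :: real assume "t \<in> {0..1}"
    then have "F t = F (1 / 2)" by (rule const)
    then show "bern 2 t = bern_fourier 2 t + F (1 / 2)"
      unfolding F_def[of t] by linarith
  qed
qed

theorem bern_eq_bern_fourier:
  assumes "n \<ge> 2" "t \<in> {0..1}"
  shows "bern n t = bern_fourier n t"
proof -
  have "\<exists>c. \<forall>t\<in>{0..1}. bern n t = bern_fourier n t + c"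
    using assms(1)
  proof (induction n rule: dec_induct)
    case base show ?case by (rule bern_2_upto_const)
  next
    case (step n)
    then show ?case using bern_eq_bern_fourier_upto_const(2)[of n] by blast
  qed
  then obtain c where c: "\<And>t. t \<in> {0..1} \<Longrightarrow> bern n t = bern_fourier n t + c" by blast
  then have "c = 0"
    by (rule bern_eq_bern_fourier_upto_const(1)[OF assms(1)])
  then show ?thesis using c assms by simp
qed

section \<open>The sequence b and its discrete Fourier transform\<close>

lemma e2pi_cis: "e2pi x = cis (2 * pi * x)"
  by (simp add: e2pi_def cis_conv_exp mult_ac)

lemma e2pi_add: "e2pi (x + y) = e2pi x * e2pi y"
  by (simp add: e2pi_cis cis_mult ring_distribs)

lemma e2pi_of_int [simp]: "e2pi (of_int n) = 1"
  unfolding e2pi_cis using cis_multiple_2pi[of "of_int n"] by simp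

lemma e2pi_add_int: "e2pi (x + of_int n) = e2pi x"
  by (simp add: e2pi_add)

lemma e2pi_half: "e2pi (1 / 2) = - 1"
  by (simp add: e2pi_cis)

lemma e2pi_odd_half: "odd n \<Longrightarrow> e2pi (of_int n / 2) = - 1"
proof (elim oddE)
  fix k assume "n = 2 * k + 1"
  then have "of_int n / 2 = 1 / 2 + (of_int k :: real)" by simp
  then show ?thesis by (simp only: e2pi_add_int e2pi_half)
qed

lemma e2pi_power: "e2pi x ^ n = e2pi (real n * x)"
  unfolding e2pi_cis Complex.DeMoivre by (simp add: mult_ac)

lemma two_tri: "2 * tri k = k * (k + 1)"
  by (simp add: tri_def)

lemma tri_reflect: "tri (- 1 - k) = tri k"
  by (simp add: tri_def algebra_simps)

lemma lam_powi: "lam h u powi n = e2pi (of_int u * of_int n / of_nat h)"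
  unfolding lam_def e2pi_cis cis_power_int by (simp add: mult_ac)

lemma b_seq_odd: "b_seq h u (2 * k + 1) = lam h u powi tri k"
  by (simp add: b_seq_def)

lemma b_seq_even: "even m \<Longrightarrow> b_seq h u m = 0"
  by (simp add: b_seq_def)

lemma b_seq_uminus: "b_seq h u (- m) = b_seq h u m"
proof (cases "odd m")
  case True
  then obtain k where k: "m = 2 * k + 1" by (elim oddE)
  then have "- m = 2 * (- 1 - k) + 1" by simp
  then show ?thesis
    unfolding k by (simp only: b_seq_odd tri_reflect)
qed (simp add: b_seq_def)

lemma norm_b_seq_le: "norm (b_seq h u m) \<le> 1"
  by (simp add: b_seq_def lam_powi e2pi_cis)

lemma odd_of_coprime_even:
  assumes "even h" "coprime u (int h)" shows "odd u"
  using assms by (meson coprime_common_divisor even_of_nat odd_one)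

text \<open>
  The exponent changes by \<open>u (2 k + 1 + h) / 2\<close>, half of an odd integer. This sign is the
  source of the symmetries of \<open>b\<close>, of \<open>P\<close> and of \<open>R\<close>.
\<close>
lemma lam_powi_tri_add_h:
  assumes "h > 0" "even h" "coprime u (int h)"
  shows "lam h u powi tri (k + int h) = - (lam h u powi tri k)"
proof -
  have "of_int u * of_int (tri (k + int h)) / of_nat h =
        of_int u * of_int (tri k) / of_nat h + of_int (u * (2 * k + 1 + int h)) / (2 :: real)"
  proof -
    have "2 * tri (k + int h) = 2 * tri k + int h * (2 * k + 1 + int h)"
      unfolding two_tri by (simp add: algebra_simps)
    moreover have "real_of_int a = of_int b + real h * of_int c / 2" if "2 * a = 2 * b + int h * c" for a b c
    proof -
      have "real_of_int (2 * a) = of_int (2 * b + int h * c)"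
        using that by (simp only:)
      then show ?thesis by simp
    qed
    ultimately have tri_h: "real_of_int (tri (k + int h)) = of_int (tri k) + real h * of_int (2 * k + 1 + int h) / 2"
      by blast
    have "real_of_int x * (y + real h * of_int c / 2) / real h = of_int x * y / real h + of_int (x * c) / 2" for x y c
      using assms(1) by (simp add: field_simps)
    then show ?thesis
      by (simp only: tri_h)
  qed
  moreover have "e2pi (of_int (u * (2 * k + 1 + int h)) / 2) = - 1"
    by (rule e2pi_odd_half) (use odd_of_coprime_even[OF assms(2,3)] assms(2) in simp)
  ultimately show ?thesis
    unfolding lam_powi by (simp only: e2pi_add mult_minus_right mult_1_right)
qed

text \<open>
  Any sum against \<open>b\<close> over one period \<open>4 h\<close> folds to half of it, by \<open>b(m + 2 h) = - b(m)\<close>.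
\<close>
lemma sum_b_seq:
  assumes "h > 0" "even h" "coprime u (int h)"
  shows "(\<Sum>r = 1..4 * h. b_seq h u (int r) * g r) =
    (\<Sum>k<h. lam h u powi tri (int k) * (g (2 * k + 1) - g (2 * k + 1 + 2 * h)))"
proof -
  have "(\<Sum>r = 1..2 * n. b_seq h u (int r) * g r) = (\<Sum>k<n. lam h u powi tri (int k) * g (2 * k + 1))" for n
  proof (induction n)
    case (Suc n)
    have "b_seq h u (int (Suc (2 * n))) = lam h u powi tri (int n)"
      using b_seq_odd[of h u "int n"] by (simp add: add.commute)
    moreover have "b_seq h u (int (Suc (Suc (2 * n)))) = 0"
      by (rule b_seq_even) simp
    ultimately show ?case
      using Suc by simp
  qed simp
  moreover have "4 * h = 2 * (2 * h)" "h + h = 2 * h"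
    by simp_all
  ultimately have "(\<Sum>r = 1..4 * h. b_seq h u (int r) * g r) =
      (\<Sum>k<h + h. lam h u powi tri (int k) * g (2 * k + 1))"
    by (simp only:)
  also have "\<dots> = (\<Sum>k<h. lam h u powi tri (int k) * g (2 * k + 1)) +
      (\<Sum>k<h. lam h u powi tri (int (k + h)) * g (2 * (k + h) + 1))"
  proof -
    have "(\<Sum>k<m + n. f k) = (\<Sum>k<m. f k) + (\<Sum>k<n. f (k + m))" for f :: "nat \<Rightarrow> complex" and m n
      by (induction n) (simp_all add: add_ac)
    then show ?thesis .
  qed
  also have "\<dots> = (\<Sum>k<h. lam h u powi tri (int k) * (g (2 * k + 1) - g (2 * k + 1 + 2 * h)))"
  proof -
    have "lam h u powi tri (int (k + h)) * g (2 * (k + h) + 1) = - (lam h u powi tri (int k) * g (2 * k + 1 + 2 * h))" for k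
    proof -
      have "2 * (k + h) + 1 = 2 * k + 1 + 2 * h" by simp
      then show ?thesis
        by (simp only: of_nat_add lam_powi_tri_add_h[OF assms] mult_minus_left)
    qed
    then show ?thesis
      by (simp add: sum_negf right_diff_distrib sum_subtractf)
  qed
  finally show ?thesis .
qed

lemma sum_shift_periodic:
  fixes f :: "int \<Rightarrow> 'a :: ab_group_add"
  assumes "\<And>k. f (k + int h) = f k"
  shows "(\<Sum>k<h. f (int k + w)) = (\<Sum>k<h. f (int k))"
proof -
  have step: "(\<Sum>k<h. f (int k + (w + 1))) = (\<Sum>k<h. f (int k + w))" for w
  proof -
    have "(\<Sum>k<h. f (int (Suc k) + w) - f (int k + w)) = f (int h + w) - f (int 0 + w)"
      by (rule sum_lessThan_telescope)
    then show ?thesis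
      using assms[of w] by (simp add: sum_subtractf add_ac)
  qed
  show ?thesis
  proof (induction w rule: int_induct[of _ 0])
    case (step2 w)
    then show ?case using step[of "w - 1"] by simp
  qed (simp_all add: step)
qed

text \<open>
  Half of the value at \<open>m\<close>, for odd \<open>m\<close>, of the discrete Fourier transform of \<open>b\<close> modulo
  \<open>4 h\<close>.
\<close>
definition gauss_sum :: "nat \<Rightarrow> int \<Rightarrow> int \<Rightarrow> complex" where
  "gauss_sum h u m = (\<Sum>k<h. lam h u powi tri (int k) * e2pi (of_int (m * (2 * int k + 1)) / (4 * real h)))"

text \<open>
  Completing the square: with \<open>v\<close> inverse to \<open>u\<close> modulo \<open>h\<close>, the summand for \<open>m = 2 j + 1\<close> is
  the summand for \<open>m = 1\<close> at the shifted index \<open>k + j v\<close>, times \<open>e(- v T_j / h)\<close>. The two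
  exponents differ by \<open>(u v - 1) / h\<close> times \<open>j k + j (v j + 1) / 2\<close>, which is an integer
  because \<open>v\<close> is odd. The shift does not matter since the summand is periodic in \<open>k\<close>.
\<close>
lemma gauss_sum_odd:
  assumes "h > 0" "even h" "coprime u (int h)"
  shows "gauss_sum h u (2 * j + 1) = gauss_sum h u 1 * b_seq h (dual_param h u) (2 * j + 1)"
proof -
  define v where "v = modular_inverse (int h) u"
  have "[u * v = 1] (mod int h)"
    unfolding v_def by (rule cong_modular_inverse1[OF assms(3)])
  then obtain t where t: "u * v = 1 + int h * t"
    by (metis cong_iff_lin cong_sym mult.commute)
  have "odd v"
    unfolding v_def using coprime_modular_inverse[OF assms(3)] assms(2) by (rule odd_of_coprime_even[rotated])
  then have "even (j * (v * j + 1))" by simp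
  then obtain i where i: "j * (v * j + 1) = 2 * i" by (elim evenE)
  define F where "F m k = lam h u powi tri k * e2pi (of_int (m * (2 * k + 1)) / (4 * real h))" for m k
  define d where "d = e2pi (of_int (- v * tri j) / real h)"
  have shift: "F (2 * j + 1) k = d * F 1 (k + j * v)" for k
  proof -
    have "4 * (- v * tri j) + 4 * (u * tri (k + j * v)) + (2 * (k + j * v) + 1) =
          4 * (u * tri k) + (2 * j + 1) * (2 * k + 1) + 4 * (int h * (t * (j * k + i)))"
      using t i two_tri[of j] two_tri[of k] two_tri[of "k + j * v"] by algebra
    moreover have "of_int a / real h + (of_int b / real h + of_int c / (4 * real h)) =
        of_int d / real h + of_int e / (4 * real h) + of_int f"
      if "4 * a + 4 * b + c = 4 * d + e + 4 * (int h * f)" for a b c d e f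
    proof -
      have "real_of_int (4 * a + 4 * b + c) = of_int (4 * d + e + 4 * (int h * f))"
        using that by (simp only:)
      then show ?thesis
        using assms(1) by (simp add: field_simps)
    qed
    ultimately have "of_int (- v * tri j) / real h + (of_int (u * tri (k + j * v)) / real h +
           of_int (1 * (2 * (k + j * v) + 1)) / (4 * real h)) =
         of_int (u * tri k) / real h + of_int ((2 * j + 1) * (2 * k + 1)) / (4 * real h)
           + of_int (t * (j * k + i))"
      unfolding mult_1 by blast
    then have "e2pi (of_int (- v * tri j) / real h + (of_int u * of_int (tri (k + j * v)) / real h +
           of_int (1 * (2 * (k + j * v) + 1)) / (4 * real h))) =
         e2pi (of_int u * of_int (tri k) / real h + of_int ((2 * j + 1) * (2 * k + 1)) / (4 * real h))"
      by (simp only: e2pi_add_int of_int_mult[of u])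
    then show ?thesis
      unfolding F_def d_def lam_powi e2pi_add by (rule sym)
  qed
  have periodic: "F 1 (k + int h) = F 1 k" for k
  proof -
    have "of_int (1 * (2 * (k + int h) + 1)) / (4 * real h) = of_int (1 * (2 * k + 1)) / (4 * real h) + 1 / 2"
      using assms(1) by (simp add: field_simps)
    then show ?thesis
      unfolding F_def lam_powi_tri_add_h[OF assms] by (simp only: e2pi_add e2pi_half) simp
  qed
  have "gauss_sum h u (2 * j + 1) = d * (\<Sum>k<h. F 1 (int k + j * v))"
    unfolding gauss_sum_def F_def[symmetric] shift sum_distrib_left ..
  also have "(\<Sum>k<h. F 1 (int k + j * v)) = (\<Sum>k<h. F 1 (int k))"
    by (rule sum_shift_periodic[of "F 1" h "j * v"]) (rule periodic)
  also have "\<dots> = gauss_sum h u 1"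
    unfolding gauss_sum_def F_def ..
  also have "d = b_seq h (dual_param h u) (2 * j + 1)"
  proof -
    have "- v = dual_param h u + int h * ((- v) div int h)"
      unfolding dual_param_def v_def[symmetric] by simp
    then have "- v * tri j = dual_param h u * tri j + int h * ((- v) div int h * tri j)"
      by algebra
    then have "real_of_int (- v * tri j) / real h = of_int (dual_param h u * tri j + int h * ((- v) div int h * tri j)) / real h"
      by (simp only:)
    also have "\<dots> = of_int (dual_param h u) * of_int (tri j) / real h + of_int ((- v) div int h * tri j)"
      using assms(1) by (simp add: add_divide_distrib)
    finally show ?thesis
      unfolding d_def b_seq_odd lam_powi by (simp only: e2pi_add_int)
  qed
  finally show ?thesis
    by (simp only: mult.commute)
qed

lemma sum_e2pi_powers:
  assumes "0 < k" "k < h"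
  shows "(\<Sum>j<h. e2pi (real k / real h) ^ j) = 0"
proof -
  have "e2pi (real k / real h) \<noteq> 1"
  proof
    assume "e2pi (real k / real h) = 1"
    then obtain n :: int where "Im (2 * of_real pi * \<i> * of_real (real k / real h)) = of_int (2 * n) * pi"
      unfolding e2pi_def exp_eq_1 by blast
    then have "(2 * pi) * (real k / real h) = (2 * pi) * of_int n"
      by simp
    then have "real k / real h = of_int n"
      by (simp only: mult_cancel_left) simp
    then have "real k = of_int (n * int h)"
      using assms by (simp add: field_simps)
    then have "int k = n * int h"
      by (metis of_int_eq_iff of_int_of_nat_eq)
    then have "int h dvd int k" by simp
    then have "h dvd k" by (simp only: int_dvd_int_iff)
    then show False
      using assms by (auto dest: dvd_imp_le)
  qed
  moreover have "e2pi (real k / real h) ^ h = 1"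
    using assms e2pi_of_int[of "int k"] by (simp add: e2pi_power)
  ultimately show ?thesis
    by (simp add: geometric_sum)
qed

text \<open>
  If the sum at \<open>1\<close> were zero, all sums at odd arguments would be, and Fourier inversion at
  the index \<open>k = 0\<close> would give \<open>h c_0 = 0\<close>.
\<close>
lemma gauss_sum_nonzero:
  assumes "h > 0" "even h" "coprime u (int h)"
  shows "gauss_sum h u 1 \<noteq> 0"
proof
  assume "gauss_sum h u 1 = 0"
  then have zero: "gauss_sum h u (2 * j + 1) = 0" for j
    by (simp only: gauss_sum_odd[OF assms] mult_zero_left)
  have "gauss_sum h u (2 * int j + 1) * e2pi (- (2 * real j + 1) / (4 * real h)) =
      (\<Sum>k<h. lam h u powi tri (int k) * e2pi (real k / (2 * real h)) * e2pi (real k / real h) ^ j)" for j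
  proof -
    have "lam h u powi tri (int k) * e2pi (of_int ((2 * int j + 1) * (2 * int k + 1)) / (4 * real h)) *
            e2pi (- (2 * real j + 1) / (4 * real h)) =
          lam h u powi tri (int k) * e2pi (real k / (2 * real h)) * e2pi (real k / real h) ^ j" for k
    proof -
      have "of_int ((2 * int j + 1) * (2 * int k + 1)) / (4 * real h) + - (2 * real j + 1) / (4 * real h) =
          real k / (2 * real h) + real j * (real k / real h)"
        using assms(1) by (simp add: field_simps)
      then show ?thesis
        unfolding e2pi_power mult.assoc by (simp only: flip: e2pi_add)
    qed
    then show ?thesis
      unfolding gauss_sum_def sum_distrib_right by (intro sum.cong refl)
  qed
  then have "0 = (\<Sum>j<h. \<Sum>k<h. lam h u powi tri (int k) * e2pi (real k / (2 * real h)) * e2pi (real k / real h) ^ j)"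
    by (simp add: zero)
  also have "\<dots> = (\<Sum>k<h. \<Sum>j<h. lam h u powi tri (int k) * e2pi (real k / (2 * real h)) * e2pi (real k / real h) ^ j)"
    by (rule sum.swap)
  also have "\<dots> = (\<Sum>k<h. lam h u powi tri (int k) * e2pi (real k / (2 * real h)) * (\<Sum>j<h. e2pi (real k / real h) ^ j))"
    by (simp only: sum_distrib_left)
  also have "\<dots> = (\<Sum>k<h. if k = 0 then of_nat h else 0)"
  proof (intro sum.cong refl)
    fix k assume "k \<in> {..<h}"
    then show "lam h u powi tri (int k) * e2pi (real k / (2 * real h)) * (\<Sum>j<h. e2pi (real k / real h) ^ j) =
        (if k = 0 then of_nat h else 0)"
      using sum_e2pi_powers[of k h] e2pi_of_int[of 0] by (cases "k = 0") (simp_all add: tri_def)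
  qed
  also have "\<dots> = of_nat h"
    using assms(1) by simp
  finally show False
    using assms(1) by simp
qed

text \<open>
  At even \<open>m\<close> the two halves of the period cancel. At odd \<open>m\<close> they agree and leave the Gauss
  sums at \<open>m\<close> and \<open>-m\<close>, which are equal because the dual sequence is even.
\<close>
lemma sum_b_seq_cos:
  assumes "h > 0" "even h" "coprime u (int h)"
  shows "(\<Sum>r = 1..4 * h. b_seq h u (int r) * of_real (cos (2 * pi * real m * (real r / real (4 * h))))) =
           2 * gauss_sum h u 1 * b_seq h (dual_param h u) (int m)"
proof -
  define x where "x k = 2 * pi * real m * (real (2 * k + 1) / real (4 * h))" for k
  have shift: "cos (2 * pi * real m * (real (2 * k + 1 + 2 * h) / real (4 * h))) = (- 1) ^ m * cos (x k)" for k
  proof -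
    have "2 * pi * real m * (real (2 * k + 1 + 2 * h) / real (4 * h)) = x k + pi * real m"
      using assms(1) by (simp add: x_def field_simps)
    then show ?thesis
      by (simp add: cos_add cos_npi2 sin_npi2 mult.commute)
  qed
  have eq: "(\<Sum>r = 1..4 * h. b_seq h u (int r) * of_real (cos (2 * pi * real m * (real r / real (4 * h))))) =
     (\<Sum>k<h. lam h u powi tri (int k) * of_real (cos (x k) - (- 1) ^ m * cos (x k)))"
    unfolding sum_b_seq[OF assms] shift of_real_diff x_def ..
  show ?thesis
  proof (cases "even m")
    case True
    then show ?thesis unfolding eq by (simp add: b_seq_even)
  next
    case False
    then obtain j where j: "int m = 2 * j + 1" by (metis even_of_nat oddE)
    have "of_real (cos (x k) - (- 1) ^ m * cos (x k)) = e2pi (of_int (int m * (2 * int k + 1)) / (4 * real h)) +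
        e2pi (of_int (- int m * (2 * int k + 1)) / (4 * real h))" for k
    proof -
      have "2 * pi * (of_int (int m * (2 * int k + 1)) / (4 * real h)) = x k"
        by (simp add: x_def field_simps)
      moreover from this have "2 * pi * (of_int (- int m * (2 * int k + 1)) / (4 * real h)) = - x k"
        by (simp only: mult_minus_left mult_minus_right of_int_minus minus_divide_left[symmetric])
      ultimately show ?thesis
        using False unfolding e2pi_cis by (simp add: complex_eq_iff)
    qed
    then have "(\<Sum>k<h. lam h u powi tri (int k) * of_real (cos (x k) - (- 1) ^ m * cos (x k))) =
        gauss_sum h u (int m) + gauss_sum h u (- int m)"
      unfolding gauss_sum_def by (simp only: distrib_left sum.distrib)
    also have "gauss_sum h u (int m) = gauss_sum h u 1 * b_seq h (dual_param h u) (int m)"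
      unfolding j by (rule gauss_sum_odd[OF assms])
    also have "gauss_sum h u (- int m) = gauss_sum h u 1 * b_seq h (dual_param h u) (int m)"
    proof -
      have "- int m = 2 * (- 1 - j) + 1" using j by simp
      then have "gauss_sum h u (- int m) = gauss_sum h u 1 * b_seq h (dual_param h u) (- int m)"
        using gauss_sum_odd[OF assms, of "- 1 - j"] by (simp only:)
      then show ?thesis by (simp only: b_seq_uminus)
    qed
    finally show ?thesis unfolding eq by simp
  qed
qed

section \<open>Values of L at integers\<close>

lemma L_fun_neg_nat:
  assumes "h > 0"
  shows "L_fun (- of_nat m) h u =
    - (of_nat (4 * h) ^ m * fact m * (\<Sum>r = 1..4 * h. b_seq h u (int r) * bern (Suc m) (of_real (real r / real (4 * h)))))"
proof -
  have "\<not> Re (- of_nat m) > 1" by simp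
  then have "L_fun (- of_nat m) h u = L_hurwitz h u (- of_nat m)"
    unfolding L_fun_def using neg_of_nat_neq_1[of m] by (simp only: if_False)
  also have "\<dots> = of_nat (4 * h) powr (of_nat m) *
      (\<Sum>r = 1..4 * h. b_seq h u (int r) * (- fact m * bern (Suc m) (of_real (real r / real (4 * h)))))"
    unfolding L_hurwitz_def minus_minus
    by (intro arg_cong2[of _ _ _ _ "(*)"] refl sum.cong) (use assms in \<open>simp only: hurwitz_zeta_neg_nat atLeastAtMost_iff
        divide_pos_pos of_nat_0_less_iff zero_less_one order_less_le_trans\<close>, auto simp: hurwitz_zeta_neg_nat)
  also have "of_nat (4 * h) powr (of_nat m) = (of_nat (4 * h) ^ m :: complex)"
    using assms by (intro powr_complexpow) simp
  finally show ?thesis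
    by (simp only: mult_minus_left mult_minus_right sum_negf sum_distrib_left mult_ac)
qed

lemma L_fun_pos_nat_sums:
  assumes "N \<ge> 2"
  shows "(\<lambda>m. b_seq h u (int (Suc m)) / of_nat (Suc m) ^ N) sums L_fun (of_nat N) h u"
proof -
  have "summable (\<lambda>m. b_seq h u (int (Suc m)) / of_nat (Suc m) ^ N)"
  proof (rule summable_comparison_test'[OF summable_inverse_squares])
    fix m :: nat
    have "real (Suc m) ^ 2 \<le> real (Suc m) ^ N"
      using assms by (intro power_increasing) auto
    then have "norm (b_seq h u (int (Suc m))) / real (Suc m) ^ N \<le> 2 / real (Suc m) ^ 2"
      using norm_b_seq_le[of h u "int (Suc m)"] by (intro frac_le) auto
    then show "norm (b_seq h u (int (Suc m)) / of_nat (Suc m) ^ N) \<le> 2 / real (Suc m) ^ 2"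
      by (simp only: norm_divide norm_power norm_of_nat)
  qed
  moreover have "L_fun (of_nat N) h u = (\<Sum>m. b_seq h u (int (Suc m)) / of_nat (Suc m) ^ N)"
  proof -
    have "of_nat (Suc m) powr (- of_nat N) = inverse (of_nat (Suc m) ^ N :: complex)" for m
      unfolding powr_minus by (subst powr_complexpow) (simp_all del: of_nat_Suc)
    then show ?thesis
      using assms unfolding L_fun_def by (simp add: divide_inverse)
  qed
  ultimately show ?thesis
    by (simp add: summable_sums)
qed

text \<open>
  Only odd \<open>m = 2 k + 1\<close> contribute, and \<open>m = 1\<close> contributes \<open>1\<close>. For \<open>m \<ge> 3\<close> the summand is
  at most \<open>3\<^bsup>-2n\<^esup> / m\<^sup>2\<close>, and \<open>1 / m\<^sup>2 \<le> 1 / (m\<^sup>2 - 1) = (1 / k - 1 / (k + 1)) / 4\<close> telescopes to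
  \<open>1 / 4\<close>.
\<close>
lemma norm_L_fun_minus_1_le:
  "norm (L_fun (of_nat (2 * n + 2)) h u - 1) \<le> (9 / 4) / 3 ^ (2 * n + 2)"
proof -
  define f where "f k = b_seq h u (2 * int k + 1) / of_nat (2 * k + 1) ^ (2 * n + 2)" for k
  define F where "F m = b_seq h u (int (Suc m)) / of_nat (Suc m) ^ (2 * n + 2)" for m
  have "(\<lambda>k. F (2 * k)) sums L_fun (of_nat (2 * n + 2)) h u \<longleftrightarrow> F sums L_fun (of_nat (2 * n + 2)) h u"
  proof (rule sums_mono_reindex)
    show "strict_mono (\<lambda>k::nat. 2 * k)" by (simp add: strict_mono_def)
    fix m :: nat assume "m \<notin> range (\<lambda>k. 2 * k)"
    then have "odd m" by (auto elim: evenE)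
    then have "b_seq h u (int (Suc m)) = 0" by (intro b_seq_even) simp
    then show "F m = 0" by (simp only: F_def div_0)
  qed
  moreover have "F sums L_fun (of_nat (2 * n + 2)) h u"
    unfolding F_def by (rule L_fun_pos_nat_sums) simp
  moreover have "F (2 * k) = f k" for k
  proof -
    have "int (Suc (2 * k)) = 2 * int k + 1" "Suc (2 * k) = 2 * k + 1" by simp_all
    then show ?thesis unfolding f_def F_def by (simp only:)
  qed
  ultimately have "f sums L_fun (of_nat (2 * n + 2)) h u" by (simp only:)
  moreover have "f 0 = 1"
    unfolding f_def using b_seq_odd[of h u 0] by (simp add: tri_def)
  ultimately have tail: "(\<lambda>k. f (Suc k)) sums (L_fun (of_nat (2 * n + 2)) h u - 1)"
    by (subst sums_Suc_iff) simp
  have "(\<lambda>k. 1 / real (Suc k) - 1 / real (Suc (Suc k))) sums (1 / real (Suc 0) - 0)"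
    by (rule telescope_sums'[of "\<lambda>k. 1 / real (Suc k)"]) (rule lim_inverse_n'[THEN LIMSEQ_Suc])
  then have telescope: "(\<lambda>k. 1 / (4 * 9 ^ n) * (1 / real (Suc k) - 1 / real (Suc (Suc k)))) sums (1 / (4 * 9 ^ n) * 1)"
    by (intro sums_mult) simp
  have "norm (f (Suc k)) \<le> 1 / (4 * 9 ^ n) * (1 / real (Suc k) - 1 / real (Suc (Suc k)))" for k
  proof -
    define x where "x = real k"
    have x: "x \<ge> 0" by (simp add: x_def)
    have "norm (f (Suc k)) = norm (b_seq h u (2 * int (Suc k) + 1)) / (2 * x + 3) ^ (2 * n + 2)"
    proof -
      have "norm (of_nat (2 * Suc k + 1) :: complex) = 2 * x + 3"
        unfolding norm_of_nat by (simp add: x_def)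
      then show ?thesis
        unfolding f_def norm_divide norm_power by (simp only:)
    qed
    also have "\<dots> \<le> 1 / (2 * x + 3) ^ (2 * n + 2)"
      using norm_b_seq_le x by (intro divide_right_mono) auto
    also have "\<dots> = 1 / ((2 * x + 3) ^ (2 * n) * (2 * x + 3)\<^sup>2)"
      by (simp only: power_add)
    also have "\<dots> \<le> 1 / (9 ^ n * (4 * (x + 1) * (x + 2)))"
    proof (rule divide_left_mono)
      have "(9 :: real) ^ n = 3 ^ (2 * n)" by (simp add: power_mult)
      also have "\<dots> \<le> (2 * x + 3) ^ (2 * n)"
        using x by (intro power_mono) auto
      finally show "9 ^ n * (4 * (x + 1) * (x + 2)) \<le> (2 * x + 3) ^ (2 * n) * (2 * x + 3)\<^sup>2"
        using x by (intro mult_mono) (auto simp: power2_eq_square algebra_simps)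
      show "0 < (2 * x + 3) ^ (2 * n) * (2 * x + 3)\<^sup>2 * (9 ^ n * (4 * (x + 1) * (x + 2)))"
        using x by (intro mult_pos_pos zero_less_power) auto
    qed simp
    also have "\<dots> = 1 / (4 * 9 ^ n) * (1 / (x + 1) - 1 / (x + 2))"
      using x by (simp add: field_simps)
    finally show ?thesis
      unfolding of_nat_Suc x_def by (simp add: add_ac)
  qed
  then have "norm (\<Sum>k. f (Suc k)) \<le> (\<Sum>k. 1 / (4 * 9 ^ n) * (1 / real (Suc k) - 1 / real (Suc (Suc k))))"
    by (intro norm_suminf_le sums_summable[OF telescope])
  also have "\<dots> = 1 / (4 * 9 ^ n)"
    using sums_unique[OF telescope] by (simp only: mult_1_right)
  also have "\<dots> = (9 / 4) / 3 ^ (2 * n + 2)"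
    by (simp add: power_add power_mult)
  finally show ?thesis
    using sums_unique[OF tail] by simp
qed

lemma bern_even_sums:
  assumes "t \<in> {0..1}"
  shows "(\<lambda>m. 2 * (- 1) ^ n * cos (2 * pi * real (Suc m) * t) / (2 * pi * real (Suc m)) ^ (2 * n + 2)) sums bern (2 * n + 2) t"
proof -
  have "cos (x - real (2 * n + 2) * pi / 2) = - ((- 1) ^ n * cos x)" for x
  proof -
    have "real (2 * n + 2) * pi / 2 = real (Suc n) * pi" by simp
    then show ?thesis
      by (simp only: cos_diff cos_npi sin_npi power_Suc) simp
  qed
  then have "(\<lambda>m. - 2 * - ((- 1) ^ n * cos (2 * pi * real (Suc m) * t)) / (2 * pi * real (Suc m)) ^ (2 * n + 2)) sums bern_fourier (2 * n + 2) t"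
    using bern_fourier_sums[of "2 * n + 2" t] by (simp only: le_add2)
  then show ?thesis
    using bern_eq_bern_fourier[of "2 * n + 2" t] assms by (simp add: mult.assoc del: of_nat_Suc)
qed

text \<open>
  Inserting the Fourier series of the Bernoulli polynomial and exchanging the finite sum over
  \<open>r\<close> with the series over \<open>m\<close> leaves the Fourier transform of \<open>b\<close>, that is, the dual
  sequence.
\<close>
theorem L_fun_functional_equation:
  assumes "h > 0" "even h" "coprime u (int h)"
  shows "L_fun (- of_nat (2 * n + 1)) h u =
    - ((- 1) ^ n * 4 * of_nat (4 * h) ^ (2 * n + 1) * fact (2 * n + 1) / of_real (2 * pi) ^ (2 * n + 2) * gauss_sum h u 1)
      * L_fun (of_nat (2 * n + 2)) h (dual_param h u)"
proof -
  let ?t = "\<lambda>r. real r / real (4 * h)"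
  \<comment> \<open>The factor in front of the dual \<open>L\<close>-value in the Bernoulli sum; the \<open>4\<close> combines
    the factor \<open>2\<close> of the Fourier series with that of \<open>sum_b_seq_cos\<close>.\<close>
  define c :: complex where "c = 4 * (- 1) ^ n * gauss_sum h u 1 / of_real (2 * pi) ^ (2 * n + 2)"
  have "(\<lambda>m. \<Sum>r = 1..4 * h. b_seq h u (int r) *
           of_real (2 * (- 1) ^ n * cos (2 * pi * real (Suc m) * ?t r) / (2 * pi * real (Suc m)) ^ (2 * n + 2)))
        sums (\<Sum>r = 1..4 * h. b_seq h u (int r) * of_real (bern (2 * n + 2) (?t r)))"
    by (intro sums_sum sums_mult sums_of_real bern_even_sums) (use assms in \<open>auto simp: divide_simps\<close>)
  moreover have "(\<Sum>r = 1..4 * h. b_seq h u (int r) *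
           of_real (2 * (- 1) ^ n * cos (2 * pi * real (Suc m) * ?t r) / (2 * pi * real (Suc m)) ^ (2 * n + 2))) =
        c * (b_seq h (dual_param h u) (int (Suc m)) / of_nat (Suc m) ^ (2 * n + 2))" for m
  proof -
    have "(\<Sum>r = 1..4 * h. b_seq h u (int r) *
           of_real (2 * (- 1) ^ n * cos (2 * pi * real (Suc m) * ?t r) / (2 * pi * real (Suc m)) ^ (2 * n + 2))) =
        (\<Sum>r = 1..4 * h. b_seq h u (int r) * of_real (cos (2 * pi * real (Suc m) * ?t r))) *
          (2 * (- 1) ^ n / (of_real (2 * pi) ^ (2 * n + 2) * of_nat (Suc m) ^ (2 * n + 2)))"
      unfolding sum_distrib_right
      by (intro sum.cong refl) (simp add: power_mult_distrib field_simps del: of_nat_Suc power_Suc)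
    also have "\<dots> = c * (b_seq h (dual_param h u) (int (Suc m)) / of_nat (Suc m) ^ (2 * n + 2))"
      unfolding sum_b_seq_cos[OF assms] c_def by (simp add: field_simps del: of_nat_Suc power_Suc)
    finally show ?thesis .
  qed
  ultimately have "(\<lambda>m. c * (b_seq h (dual_param h u) (int (Suc m)) / of_nat (Suc m) ^ (2 * n + 2)))
        sums (\<Sum>r = 1..4 * h. b_seq h u (int r) * of_real (bern (2 * n + 2) (?t r)))"
    by (simp only:)
  moreover have "(\<lambda>m. c * (b_seq h (dual_param h u) (int (Suc m)) / of_nat (Suc m) ^ (2 * n + 2)))
        sums (c * L_fun (of_nat (2 * n + 2)) h (dual_param h u))"
    by (intro sums_mult L_fun_pos_nat_sums) simp
  ultimately have *: "(\<Sum>r = 1..4 * h. b_seq h u (int r) * of_real (bern (2 * n + 2) (?t r))) =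
        c * L_fun (of_nat (2 * n + 2)) h (dual_param h u)"
    by (rule sums_unique2)
  have "Suc (2 * n + 1) = 2 * n + 2" by simp
  then have "L_fun (- of_nat (2 * n + 1)) h u =
      - (of_nat (4 * h) ^ (2 * n + 1) * fact (2 * n + 1) * (c * L_fun (of_nat (2 * n + 2)) h (dual_param h u)))"
    unfolding L_fun_neg_nat[OF assms(1)] bern_of_real by (simp only: *)
  then show ?thesis
    unfolding c_def by (simp only: times_divide_eq_left times_divide_eq_right mult_minus_left mult_minus_right mult_ac)
qed

section \<open>The generating function\<close>

lemma poly_P_poly: "poly (P_poly h u) Y = (\<Sum>k<h. lam h u powi tri (int k) * Y ^ k)"
  by (simp add: P_poly_def poly_sum poly_monom)

lemma P_poly_antipalindromic:
  assumes "h > 0" "even h" "coprime u (int h)" "Y \<noteq> 0"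
  shows "Y ^ (h - 1) * poly (P_poly h u) (inverse Y) = - poly (P_poly h u) Y"
proof -
  have "Y ^ (h - 1) * poly (P_poly h u) (inverse Y) =
      (\<Sum>k<h. lam h u powi tri (int k) * Y ^ (h - Suc k))"
    unfolding poly_P_poly sum_distrib_left
  proof (intro sum.cong refl)
    fix k assume "k \<in> {..<h}"
    then have "h - 1 = (h - Suc k) + k" by simp
    then have "Y ^ (h - 1) = Y ^ (h - Suc k) * Y ^ k"
      by (simp only: power_add)
    then show "Y ^ (h - 1) * (lam h u powi tri (int k) * inverse Y ^ k) =
        lam h u powi tri (int k) * Y ^ (h - Suc k)"
      using assms(4) by (simp add: power_inverse)
  qed
  also have "\<dots> = (\<Sum>k<h. lam h u powi tri (int (h - Suc k)) * Y ^ (h - Suc (h - Suc k)))"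
    by (rule sum.nat_diff_reindex[symmetric])
  also have "\<dots> = (\<Sum>k<h. - (lam h u powi tri (int k) * Y ^ k))"
  proof (intro sum.cong refl)
    fix k assume "k \<in> {..<h}"
    then have "int (h - Suc k) = (- 1 - int k) + int h" "h - Suc (h - Suc k) = k" by auto
    then show "lam h u powi tri (int (h - Suc k)) * Y ^ (h - Suc (h - Suc k)) =
        - (lam h u powi tri (int k) * Y ^ k)"
      by (simp only: lam_powi_tri_add_h[OF assms(1-3)] tri_reflect mult_minus_left)
  qed
  finally show ?thesis
    unfolding poly_P_poly by (simp only: sum_negf)
qed

lemma R_fun_odd:
  assumes "h > 0" "even h" "coprime u (int h)"
  shows "R_fun h u (- x) = - R_fun h u x"
proof -
  have "exp ((1 - of_nat h) * (- x)) = exp ((1 - of_nat h) * x) * exp (2 * x) ^ (h - 1)"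
    using assms(1) by (simp add: of_nat_diff algebra_simps flip: exp_of_nat_mult exp_add)
  moreover have "exp (2 * (- x)) = inverse (exp (2 * x))"
    by (simp add: exp_minus)
  ultimately have "R_fun h u (- x) = exp ((1 - of_nat h) * x) *
      (exp (2 * x) ^ (h - 1) * poly (P_poly h u) (inverse (exp (2 * x))))"
    unfolding R_fun_def by (simp only: mult.assoc)
  then show ?thesis
    unfolding P_poly_antipalindromic[OF assms exp_not_eq_zero] R_fun_def by (simp only: mult_minus_right)
qed

lemma P_poly_1_eq_0:
  assumes "h > 0" "even h" "coprime u (int h)"
  shows "poly (P_poly h u) 1 = 0"
  using P_poly_antipalindromic[OF assms, of 1] by simp

lemma R_fun_holomorphic: "R_fun h u holomorphic_on A"
proof -
  have "R_fun h u = (\<lambda>x. exp ((1 - of_nat h) * x) * (\<Sum>k<h. lam h u powi tri (int k) * exp (2 * x) ^ k))"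
    by (rule ext) (simp only: R_fun_def poly_P_poly)
  moreover have "(\<lambda>x. exp ((1 - of_nat h) * x) * (\<Sum>k<h. lam h u powi tri (int k) * exp (2 * x) ^ k)) holomorphic_on A"
    by (intro holomorphic_intros)
  ultimately show ?thesis by (simp only:)
qed

lemma deriv_R_fun_0:
  assumes "h > 0" "even h" "coprime u (int h)"
  shows "(R_fun h u has_field_derivative 2 * poly (pderiv (P_poly h u)) 1) (at 0)"
proof -
  have "((\<lambda>x. exp ((1 - of_nat h) * x) * poly (P_poly h u) (exp (2 * x))) has_field_derivative
      (exp ((1 - of_nat h) * 0) * (1 - of_nat h)) * poly (P_poly h u) (exp (2 * 0)) +
      (poly (pderiv (P_poly h u)) (exp (2 * 0)) * (exp (2 * 0) * 2)) * exp ((1 - of_nat h) * 0)) (at 0)"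
  proof (rule DERIV_mult)
    show "((\<lambda>x. exp ((1 - of_nat h) * x)) has_field_derivative exp ((1 - of_nat h) * 0) * (1 - of_nat h :: complex)) (at 0)"
      by (auto intro!: derivative_eq_intros)
    have "((\<lambda>x. exp (2 * x)) has_field_derivative exp (2 * 0) * (2 :: complex)) (at 0)"
      by (auto intro!: derivative_eq_intros)
    then show "((\<lambda>x. poly (P_poly h u) (exp (2 * x))) has_field_derivative
       poly (pderiv (P_poly h u)) (exp (2 * 0)) * (exp (2 * 0) * 2)) (at 0)"
      by (rule DERIV_chain2[OF poly_DERIV])
  qed
  then show ?thesis
    using P_poly_1_eq_0[OF assms] by (simp add: R_fun_def[abs_def] mult.commute)
qed

text \<open>
  With \<open>e = e\<^bsup>hx\<^esup>\<close>, folding the period gives \<open>(1 - e\<^sup>2) e R(x)\<close> for the sum over \<open>r\<close>, and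
  \<open>e\<^sup>4 - 1 = - (1 - e\<^sup>2) e (e + 1 / e)\<close>.
\<close>
lemma R_fun_cosh_exp:
  assumes "h > 0" "even h" "coprime u (int h)" "cosh (of_nat h * x) \<noteq> 0"
  shows "R_fun h u x / (2 * cosh (of_nat h * x)) * (exp (of_nat (4 * h) * x) - 1) =
    - (\<Sum>r = 1..4 * h. b_seq h u (int r) * exp (of_nat r * x))"
proof -
  define e where "e = exp (of_nat h * x)"
  have e0: "e \<noteq> 0" by (simp add: e_def)
  have pow: "exp (of_nat (n * h) * x) = e ^ n" for n
    unfolding e_def exp_of_nat_mult[symmetric] by (simp add: mult_ac)
  have cosh: "2 * cosh (of_nat h * x) = e + inverse e"
    by (simp add: cosh_def e_def exp_minus scaleR_conv_of_real)
  have "(\<Sum>r = 1..4 * h. b_seq h u (int r) * exp (of_nat r * x)) =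
      (\<Sum>k<h. lam h u powi tri (int k) * (exp (of_nat (2 * k + 1) * x) - exp (of_nat (2 * k + 1 + 2 * h) * x)))"
    by (rule sum_b_seq[OF assms(1-3)])
  also have "\<dots> = (\<Sum>k<h. (1 - e ^ 2) * (e * exp ((1 - of_nat h) * x)) * (lam h u powi tri (int k) * exp (2 * x) ^ k))"
  proof (intro sum.cong refl)
    fix k
    have *: "exp (of_nat (2 * k + 1) * x) = e * exp ((1 - of_nat h) * x) * exp (2 * x) ^ k"
      unfolding e_def by (simp add: algebra_simps flip: exp_of_nat_mult exp_add)
    have "exp (of_nat (2 * k + 1 + 2 * h) * x) = exp (of_nat (2 * k + 1) * x) * e ^ 2"
      unfolding pow[symmetric] exp_add[symmetric] by (simp add: algebra_simps)
    then show "lam h u powi tri (int k) * (exp (of_nat (2 * k + 1) * x) - exp (of_nat (2 * k + 1 + 2 * h) * x)) =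
        (1 - e ^ 2) * (e * exp ((1 - of_nat h) * x)) * (lam h u powi tri (int k) * exp (2 * x) ^ k)"
      unfolding * by (simp add: algebra_simps)
  qed
  also have "\<dots> = (1 - e ^ 2) * e * R_fun h u x"
    unfolding R_fun_def poly_P_poly sum_distrib_left by (simp add: mult_ac)
  finally have sum: "(\<Sum>r = 1..4 * h. b_seq h u (int r) * exp (of_nat r * x)) = (1 - e ^ 2) * e * R_fun h u x" .
  have nz: "e + inverse e \<noteq> 0"
    using assms(4) cosh by auto
  have "e ^ 4 - 1 = - ((1 - e ^ 2) * e * (e + inverse e))"
    using e0 by (simp add: field_simps power2_eq_square power4_eq_xxxx)
  then show ?thesis
    unfolding sum pow cosh using nz by simp
qed

text \<open>
  The generating function runs over all arguments \<open>-n\<close>, because only then does it satisfy a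
  linear equation over the exponential series; the terms with even \<open>n\<close> are removed later, by
  the oddness of \<open>R\<close>.
\<close>
definition L_fps :: "nat \<Rightarrow> int \<Rightarrow> complex fps" where
  "L_fps h u = Abs_fps (\<lambda>n. L_fun (- of_nat n) h u / fact n)"

text \<open>
  Multiplying the generating function by \<open>q X\<close> with \<open>q = 4 h\<close> brings it into the form of
  \<open>bern_fps_scaled\<close>; the constant coefficient on the other side is minus the sum of \<open>b\<close> over
  a period, which is zero.
\<close>
lemma L_fps_mult:
  assumes "h > 0" "even h" "coprime u (int h)"
  shows "L_fps h u * (fps_exp (of_nat (4 * h)) - 1) =
    - (\<Sum>r = 1..4 * h. fps_const (b_seq h u (int r)) * fps_exp (of_nat r))"
proof -
  define q :: complex where "q = of_nat (4 * h)"
  have q: "q \<noteq> 0" using assms(1) by (simp add: q_def)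
  define B where "B = Abs_fps (\<lambda>j. of_real (bern_coeff j) * q ^ j)"
  define S where "S = (\<Sum>r = 1..4 * h. fps_const (b_seq h u (int r)) * fps_exp (of_nat r))"
  have nth: "fps_nth (B * S) n = (\<Sum>r = 1..4 * h. b_seq h u (int r) * (q ^ n * bern n (of_nat r / q)))" for n
  proof -
    have "B * S = (\<Sum>r = 1..4 * h. fps_const (b_seq h u (int r)) * (B * fps_exp (of_nat r)))"
      unfolding S_def sum_distrib_left by (simp only: mult.left_commute)
    then show ?thesis
      unfolding B_def by (simp only: fps_sum_nth fps_mult_left_const_nth bern_fps_scaled(2)[OF q])
  qed
  have "fps_const q * fps_X * L_fps h u = - (B * S)"
  proof (rule fps_ext)
    fix n
    show "fps_nth (fps_const q * fps_X * L_fps h u) n = fps_nth (- (B * S)) n"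
    proof (cases n)
      case 0
      have "(\<Sum>r = 1..4 * h. b_seq h u (int r)) = 0"
        using sum_b_seq[OF assms, of "\<lambda>_. 1"] by simp
      then show ?thesis
        unfolding 0 fps_neg_nth nth by (simp add: bern_def bern_coeff_0)
    next
      case (Suc m)
      have "of_real (real r / real (4 * h)) = of_nat r / q" for r
        by (simp add: q_def)
      then have "L_fun (- of_nat m) h u = - (q ^ m * fact m * (\<Sum>r = 1..4 * h. b_seq h u (int r) * bern (Suc m) (of_nat r / q)))"
        unfolding L_fun_neg_nat[OF assms(1)] by (simp only: q_def)
      then have "q * (L_fun (- of_nat m) h u / fact m) =
          - (q ^ Suc m * (\<Sum>r = 1..4 * h. b_seq h u (int r) * bern (Suc m) (of_nat r / q)))"
        by simp
      then have "q * (L_fun (- of_nat m) h u / fact m) =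
          - (\<Sum>r = 1..4 * h. b_seq h u (int r) * (q ^ Suc m * bern (Suc m) (of_nat r / q)))"
        unfolding sum_distrib_left by (simp only: mult.left_commute)
      then show ?thesis
        unfolding Suc fps_neg_nth nth by (simp add: L_fps_def mult.assoc)
    qed
  qed
  then have "fps_const q * fps_X * (L_fps h u * (fps_exp q - 1)) = - (B * (fps_exp q - 1) * S)"
    by (metis (no_types, lifting) mult.assoc mult.commute mult_minus_left)
  also have "B * (fps_exp q - 1) = fps_const q * fps_X"
    unfolding B_def by (rule bern_fps_scaled(1)[OF q])
  finally have "fps_const q * fps_X * (L_fps h u * (fps_exp q - 1)) = fps_const q * fps_X * (- S)"
    by (simp only: mult_minus_right)
  moreover have "fps_const q * fps_X \<noteq> 0"
    using q by simp
  ultimately have "L_fps h u * (fps_exp q - 1) = - S"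
    using mult_left_cancel by blast
  then show ?thesis by (simp only: q_def S_def)
qed

lemma R_fun_div_cosh_holomorphic_near_0:
  "\<exists>\<rho>>0. (\<lambda>x. R_fun h u x / (2 * cosh (of_nat h * x))) holomorphic_on ball 0 \<rho> \<and>
     (\<forall>x\<in>ball (0 :: complex) \<rho>. cosh (of_nat h * x) \<noteq> 0)"
proof -
  have cosh: "(\<lambda>x. cosh (of_nat h * x :: complex)) holomorphic_on A" for A
    unfolding cosh_def by (intro holomorphic_intros)
  have "isCont (\<lambda>x. cosh (of_nat h * x :: complex)) 0"
    using holomorphic_on_imp_continuous_on[OF cosh[of UNIV]] by (simp add: continuous_on_eq_continuous_at)
  moreover have "cosh (of_nat h * 0 :: complex) \<noteq> 0" by simp
  ultimately obtain \<rho> where \<rho>: "\<rho> > 0" "\<forall>x. dist 0 x < \<rho> \<longrightarrow> cosh (of_nat h * x :: complex) \<noteq> 0"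
    using continuous_at_avoid[of 0 "\<lambda>x. cosh (of_nat h * x :: complex)" 0] by metis
  then have nz: "cosh (of_nat h * x :: complex) \<noteq> 0" if "x \<in> ball 0 \<rho>" for x
    using \<rho>(2) that unfolding mem_ball by blast
  have "(\<lambda>x. R_fun h u x / (2 * cosh (of_nat h * x))) holomorphic_on ball 0 \<rho>"
  proof (intro holomorphic_on_divide holomorphic_on_mult holomorphic_on_const R_fun_holomorphic cosh)
    fix x :: complex assume "x \<in> ball 0 \<rho>"
    then show "2 * cosh (of_nat h * x) \<noteq> 0"
      using nz by (simp only: mult_eq_0_iff) simp
  qed
  with \<rho>(1) nz show ?thesis by (intro exI[of _ \<rho>] conjI ballI)
qed

text \<open>
  Both power series satisfy the same equation after multiplication by \<open>e\<^bsup>4hX\<^esup> - 1\<close>, and this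
  factor can be cancelled.
\<close>
theorem L_fps_expansion:
  assumes "h > 0" "even h" "coprime u (int h)"
  shows "(\<lambda>x. R_fun h u x / (2 * cosh (of_nat h * x))) has_fps_expansion L_fps h u"
proof -
  define F where "F x = R_fun h u x / (2 * cosh (of_nat h * x))" for x
  have "\<exists>\<rho>>0. F holomorphic_on ball 0 \<rho> \<and> (\<forall>x\<in>ball (0 :: complex) \<rho>. cosh (of_nat h * x) \<noteq> 0)"
    unfolding F_def[abs_def] by (rule R_fun_div_cosh_holomorphic_near_0)
  then obtain \<rho> where \<rho>: "\<rho> > 0" "\<And>x. x \<in> ball 0 \<rho> \<Longrightarrow> cosh (of_nat h * x :: complex) \<noteq> 0"
    and hol: "F holomorphic_on ball 0 \<rho>"
    by blast
  have "F analytic_on {0}"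
    unfolding analytic_at using \<rho>(1) hol by (intro exI[of _ "ball 0 \<rho>"]) simp
  then have F: "F has_fps_expansion fps_expansion F 0"
    by (rule analytic_at_imp_has_fps_expansion_0)
  let ?E = "fps_exp (of_nat (4 * h)) - 1 :: complex fps"
  let ?S = "- (\<Sum>r = 1..4 * h. fps_const (b_seq h u (int r)) * fps_exp (of_nat r))"
  have 1: "(\<lambda>x. F x * (exp (of_nat (4 * h) * x) - 1)) has_fps_expansion fps_expansion F 0 * ?E"
    by (intro has_fps_expansion_mult F has_fps_expansion_diff has_fps_expansion_exp has_fps_expansion_1)
  have 2: "(\<lambda>x. - (\<Sum>r = 1..4 * h. b_seq h u (int r) * exp (of_nat r * x))) has_fps_expansion ?S"
    by (intro has_fps_expansion_minus has_fps_expansion_sum has_fps_expansion_cmult_left has_fps_expansion_exp)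
  have "\<forall>\<^sub>F x in nhds 0. F x * (exp (of_nat (4 * h) * x) - 1) = - (\<Sum>r = 1..4 * h. b_seq h u (int r) * exp (of_nat r * x))"
    unfolding F_def
  proof (rule eventually_mono)
    show "\<forall>\<^sub>F x in nhds 0. x \<in> ball 0 \<rho>"
      by (rule eventually_nhds_in_open) (use \<rho>(1) in simp_all)
  qed (rule R_fun_cosh_exp[OF assms \<rho>(2)])
  then have "(\<lambda>x. - (\<Sum>r = 1..4 * h. b_seq h u (int r) * exp (of_nat r * x))) has_fps_expansion fps_expansion F 0 * ?E"
    using 1 by (simp only: has_fps_expansion_cong)
  then have "fps_expansion F 0 * ?E = ?S"
    using 2 fps_expansion_unique_complex by blast
  then have "fps_expansion F 0 * ?E = L_fps h u * ?E"
    by (simp only: L_fps_mult[OF assms])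
  moreover have "?E \<noteq> 0"
  proof
    assume "?E = 0"
    then have "fps_nth ?E 1 = 0" by (simp only: fps_zero_nth)
    then show False using assms(1) by simp
  qed
  ultimately have "fps_expansion F 0 = L_fps h u"
    using mult_right_cancel by blast
  with F show ?thesis
    unfolding F_def by (simp only:)
qed

text \<open>
  The odd part of the power series is again a power series for the odd function
  \<open>R(x) / (2 cosh (h x))\<close>, so the even terms can be dropped without computing them.
\<close>
theorem L_fun_odd_sums:
  assumes "h > 0" "even h" "coprime u (int h)"
  shows "\<forall>\<^sub>F x in nhds 0. (\<lambda>n. L_fun (- of_nat (2 * n + 1)) h u * (x ^ (2 * n + 1) / fact (2 * n + 1)))
          sums (R_fun h u x / (2 * cosh (of_nat h * x)))"
proof -
  define F where "F x = R_fun h u x / (2 * cosh (of_nat h * x))" for x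
  have "\<exists>\<rho>>0. F holomorphic_on ball 0 \<rho> \<and> (\<forall>x\<in>ball (0 :: complex) \<rho>. cosh (of_nat h * x) \<noteq> 0)"
    unfolding F_def[abs_def] by (rule R_fun_div_cosh_holomorphic_near_0)
  then obtain \<rho> where \<rho>: "\<rho> > 0" and hol: "F holomorphic_on ball 0 \<rho>"
    by blast
  have fps: "F has_fps_expansion L_fps h u"
    unfolding F_def by (rule L_fps_expansion[OF assms])
  have "(\<lambda>n. L_fun (- of_nat (2 * n + 1)) h u * (x ^ (2 * n + 1) / fact (2 * n + 1))) sums F x"
    if x: "x \<in> ball 0 \<rho>" for x
  proof -
    have sums: "(\<lambda>n. fps_nth (L_fps h u) n * y ^ n) sums F y" if "norm y < \<rho>" for y
      by (rule has_fps_expansion_imp_sums_complex[OF fps, of "ereal \<rho>"]) (use hol that in simp_all)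
    define g where "g n = (fps_nth (L_fps h u) n * x ^ n - fps_nth (L_fps h u) n * (- x) ^ n) / 2" for n
    have "g sums ((F x - F (- x)) / 2)"
      unfolding g_def by (intro sums_divide sums_diff sums) (use x in simp_all)
    also have "(F x - F (- x)) / 2 = F x"
      unfolding F_def R_fun_odd[OF assms] by simp
    finally have g: "g sums F x" .
    have "(\<lambda>n. g (2 * n + 1)) sums F x \<longleftrightarrow> g sums F x"
    proof (rule sums_mono_reindex)
      show "strict_mono (\<lambda>n::nat. 2 * n + 1)" by (simp add: strict_mono_def)
      fix n :: nat assume "n \<notin> range (\<lambda>n. 2 * n + 1)"
      then have "even n" by (rule contrapos_np) (auto elim!: oddE)
      then show "g n = 0" by (simp add: g_def)
    qed
    with g have "(\<lambda>n. g (2 * n + 1)) sums F x" by (simp only:)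
    moreover have "g (2 * n + 1) = L_fun (- of_nat (2 * n + 1)) h u * (x ^ (2 * n + 1) / fact (2 * n + 1))" for n
    proof -
      have "(- x) ^ (2 * n + 1) = - (x ^ (2 * n + 1))" by simp
      then show ?thesis
        unfolding g_def L_fps_def fps_nth_Abs_fps by (simp only: mult_minus_right) (simp del: fact_Suc)
    qed
    ultimately show ?thesis by (simp only:)
  qed
  moreover have "\<forall>\<^sub>F x in nhds 0. x \<in> ball 0 \<rho>"
    by (rule eventually_nhds_in_open) (use \<rho> in simp_all)
  ultimately show ?thesis
    unfolding F_def by (rule eventually_mono[rotated])
qed

lemma L_fun_neg_1:
  assumes "h > 0" "even h" "coprime u (int h)"
  shows "L_fun (- of_nat 1) h u = poly (pderiv (P_poly h u)) 1"
proof -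
  have "((\<lambda>x. R_fun h u x / (2 * cosh (of_nat h * x))) has_field_derivative poly (pderiv (P_poly h u)) 1) (at 0)"
  proof -
    have "((\<lambda>x. 2 * cosh (of_nat h * x :: complex)) has_field_derivative 0) (at 0)"
      by (auto intro!: derivative_eq_intros)
    from DERIV_divide[OF deriv_R_fun_0[OF assms] this] show ?thesis by simp
  qed
  then have "deriv (\<lambda>x. R_fun h u x / (2 * cosh (of_nat h * x))) 0 = poly (pderiv (P_poly h u)) 1"
    by (rule DERIV_imp_deriv)
  moreover have "fps_nth (L_fps h u) 1 = deriv (\<lambda>x. R_fun h u x / (2 * cosh (of_nat h * x))) 0"
    using fps_expansion_eqI[OF L_fps_expansion[OF assms]] by (simp add: fps_expansion_def flip: fps_expansion_eqI[OF L_fps_expansion[OF assms]])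
  ultimately show ?thesis
    by (simp add: L_fps_def)
qed

section \<open>The values at negative odd integers\<close>

theorem theorem5p3:
  fixes h :: nat and u :: int
  assumes "h \<ge> 2" and "even h" and "coprime u (int h)"
  shows
    "(\<forall>Y::complex. Y \<noteq> 0 \<longrightarrow> Y ^ (h - 1) * poly (P_poly h u) (inverse Y) = - poly (P_poly h u) Y) \<and>
     (\<forall>x. R_fun h u (- x) = - R_fun h u x) \<and>
     L_fun (- 1) h u = poly (pderiv (P_poly h u)) 1 \<and>
     poly (pderiv (P_poly h u)) 1 = 1 / 2 * deriv (R_fun h u) 0 \<and>
     (\<forall>\<^sub>F x in nhds (0::complex).
        (\<lambda>n. L_fun (- 2 * of_nat n - 1) h u * (x ^ (2 * n + 1) / fact (2 * n + 1)))
          sums (R_fun h u x / (2 * cosh (of_nat h * x)))) \<and>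
     (\<forall>\<^sub>F x in nhds (0::complex).
        (\<lambda>n. A_ratio n h u * (x ^ (2 * n + 1) / fact (2 * n + 1)))
          sums (R_fun h u x / (deriv (R_fun h u) 0 * cosh (of_nat h * x)))) \<and>
     (\<forall>n. A_ratio n h u =
        (- 1) ^ n * fact (2 * n + 1) * of_real (2 * real h / pi) ^ (2 * n) *
          (L_fun (2 * of_nat n + 2) h (dual_param h u) / L_fun 2 h (dual_param h u))) \<and>
     (\<exists>E :: nat \<Rightarrow> complex.
        E \<in> O(\<lambda>n. 1 / 3 ^ (2 * n + 2)) \<and>
        (\<forall>n. A_ratio n h u =
           (- 1) ^ n * fact (2 * n + 1) / L_fun 2 h (dual_param h u) *
             of_real (2 * real h / pi) ^ (2 * n) * (1 + E n)))"
proof (intro conjI)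
  have h: "h > 0" using assms(1) by simp
  note hu = h assms(2,3)
  have neg: "- 2 * of_nat n - 1 = (- of_nat (2 * n + 1) :: complex)" for n
    by simp
  have pos: "2 * of_nat n + 2 = (of_nat (2 * n + 2) :: complex)" for n
    by simp
  have one: "- 1 = (- of_nat 1 :: complex)"
    by simp
  have deriv_R: "deriv (R_fun h u) 0 = 2 * poly (pderiv (P_poly h u)) 1"
    by (rule DERIV_imp_deriv[OF deriv_R_fun_0[OF hu]])
  show "\<forall>Y::complex. Y \<noteq> 0 \<longrightarrow> Y ^ (h - 1) * poly (P_poly h u) (inverse Y) = - poly (P_poly h u) Y"
    using P_poly_antipalindromic[OF hu] by blast
  show "\<forall>x. R_fun h u (- x) = - R_fun h u x"
    using R_fun_odd[OF hu] by blast
  show L1: "L_fun (- 1) h u = poly (pderiv (P_poly h u)) 1"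
    unfolding one by (rule L_fun_neg_1[OF hu])
  show "poly (pderiv (P_poly h u)) 1 = 1 / 2 * deriv (R_fun h u) 0"
    by (simp add: deriv_R)
  show gen: "\<forall>\<^sub>F x in nhds (0::complex).
        (\<lambda>n. L_fun (- 2 * of_nat n - 1) h u * (x ^ (2 * n + 1) / fact (2 * n + 1)))
          sums (R_fun h u x / (2 * cosh (of_nat h * x)))"
    unfolding neg by (rule L_fun_odd_sums[OF hu])
  show "\<forall>\<^sub>F x in nhds (0::complex).
        (\<lambda>n. A_ratio n h u * (x ^ (2 * n + 1) / fact (2 * n + 1)))
          sums (R_fun h u x / (deriv (R_fun h u) 0 * cosh (of_nat h * x)))"
    using gen
  proof (rule eventually_mono)
    fix x
    assume "(\<lambda>n. L_fun (- 2 * of_nat n - 1) h u * (x ^ (2 * n + 1) / fact (2 * n + 1)))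
          sums (R_fun h u x / (2 * cosh (of_nat h * x)))"
    then have "(\<lambda>n. L_fun (- 2 * of_nat n - 1) h u * (x ^ (2 * n + 1) / fact (2 * n + 1)) / L_fun (- 1) h u)
          sums (R_fun h u x / (2 * cosh (of_nat h * x)) / L_fun (- 1) h u)"
      by (rule sums_divide)
    moreover have "R_fun h u x / (2 * cosh (of_nat h * x)) / L_fun (- 1) h u =
        R_fun h u x / (deriv (R_fun h u) 0 * cosh (of_nat h * x))"
      unfolding deriv_R L1 by (simp only: divide_divide_eq_left mult_ac)
    ultimately show "(\<lambda>n. A_ratio n h u * (x ^ (2 * n + 1) / fact (2 * n + 1)))
          sums (R_fun h u x / (deriv (R_fun h u) 0 * cosh (of_nat h * x)))"
      unfolding A_ratio_def by (simp only: times_divide_eq_left)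
  qed
  let ?w = "dual_param h u"
  have A: "A_ratio n h u =
        (- 1) ^ n * fact (2 * n + 1) * of_real (2 * real h / pi) ^ (2 * n) *
          (L_fun (of_nat (2 * n + 2)) h ?w / L_fun (of_nat 2) h ?w)" for n
  proof -
    \<comment> \<open>The factor in \<open>L(-2n-1) = K_n L(2n+2)\<close>; the Gauss sum cancels in \<open>K_n / K_0\<close>.\<close>
    define K where "K n = - ((- 1) ^ n * 4 * of_nat (4 * h) ^ (2 * n + 1) * fact (2 * n + 1) /
      of_real (2 * pi) ^ (2 * n + 2) * gauss_sum h u 1)" for n
    have eq: "L_fun (- of_nat (2 * n + 1)) h u = K n * L_fun (of_nat (2 * n + 2)) h ?w" for n
      unfolding K_def by (rule L_fun_functional_equation[OF hu])
    have e0: "L_fun (- 1) h u = K 0 * L_fun (of_nat 2) h ?w"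
      using eq[of 0] by simp
    have K: "K n = K 0 * ((- 1) ^ n * fact (2 * n + 1) * of_real (2 * real h / pi) ^ (2 * n))"
    proof -
      have "(of_real (2 * real h / pi) :: complex) = of_nat (4 * h) / of_real (2 * pi)"
        by simp
      moreover have "- (s * 4 * a ^ (2 * n + 1) * f / b ^ (2 * n + 2) * g) =
          - (1 * 4 * a * 1 / (b * b) * g) * (s * f * (a / b) ^ (2 * n))" for s a b f g :: complex
        by (simp add: power_add power_divide mult_ac)
      moreover have "K 0 = - (1 * 4 * of_nat (4 * h) * 1 / (of_real (2 * pi) * of_real (2 * pi)) * gauss_sum h u 1)"
        unfolding K_def by (simp add: power2_eq_square)
      ultimately show ?thesis
        by (simp only: K_def[of n])
    qed
    have "K 0 \<noteq> 0"
      unfolding K_def using gauss_sum_nonzero[OF hu] h by simp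
    have "A_ratio n h u = (K n * L_fun (of_nat (2 * n + 2)) h ?w) / (K 0 * L_fun (of_nat 2) h ?w)"
      unfolding A_ratio_def neg eq e0 ..
    also have "\<dots> = (K n / K 0) * (L_fun (of_nat (2 * n + 2)) h ?w / L_fun (of_nat 2) h ?w)"
      by (simp only: times_divide_times_eq)
    also have "K n / K 0 = (- 1) ^ n * fact (2 * n + 1) * of_real (2 * real h / pi) ^ (2 * n)"
      using \<open>K 0 \<noteq> 0\<close> unfolding K by (rule nonzero_mult_div_cancel_left)
    finally show ?thesis .
  qed
  show "\<forall>n. A_ratio n h u =
        (- 1) ^ n * fact (2 * n + 1) * of_real (2 * real h / pi) ^ (2 * n) *
          (L_fun (2 * of_nat n + 2) h ?w / L_fun 2 h ?w)"
    unfolding pos A by simp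
  show "\<exists>E :: nat \<Rightarrow> complex.
        E \<in> O(\<lambda>n. 1 / 3 ^ (2 * n + 2)) \<and>
        (\<forall>n. A_ratio n h u =
           (- 1) ^ n * fact (2 * n + 1) / L_fun 2 h ?w *
             of_real (2 * real h / pi) ^ (2 * n) * (1 + E n))"
  proof (intro exI[of _ "\<lambda>n. L_fun (of_nat (2 * n + 2)) h ?w - 1"] conjI allI)
    show "(\<lambda>n. L_fun (of_nat (2 * n + 2)) h ?w - 1) \<in> O(\<lambda>n. 1 / 3 ^ (2 * n + 2))"
    proof (rule bigoI[of _ "9 / 4"], rule always_eventually, rule allI)
      fix n
      have "norm (1 / 3 ^ (2 * n + 2) :: complex) = 1 / 3 ^ (2 * n + 2)"
        by (simp only: norm_divide norm_power norm_one norm_numeral)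
      then show "norm (L_fun (of_nat (2 * n + 2)) h ?w - 1) \<le> 9 / 4 * norm (1 / 3 ^ (2 * n + 2) :: complex)"
        using norm_L_fun_minus_1_le[of n h ?w] by (simp only: times_divide_eq_right mult_1_right)
    qed
  next
    fix n
    show "A_ratio n h u = (- 1) ^ n * fact (2 * n + 1) / L_fun 2 h ?w *
             of_real (2 * real h / pi) ^ (2 * n) * (1 + (L_fun (of_nat (2 * n + 2)) h ?w - 1))"
      unfolding A of_nat_numeral add_diff_eq add_diff_cancel_left'
      by (simp only: times_divide_eq_left times_divide_eq_right)
  qed
qed

end
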